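(* Let $\mathbf n=(n_1,\dots,n_k)\in\mathbb N^k$, let $\varphi=\sum_{(\alpha)}A_{(\alpha)}\otimes Z_{(\alpha)}$ be a formal power series with coefficients $A_{(\alpha)}\in B(\mathcal K)$, and define $\gamma\in[0,\infty]$ by $$\frac1\gamma:=\limsup_{(p_1,\dots,p_k)\in\mathbb Z_+^k}\Big\|\sum_{\substack{\alpha_i\in\mathbb F_{n_i}^+,\ |\alpha_i|=p_i\\ i\in\{1,\dots,k\}}}A_{(\alpha)}^*A_{(\alpha)}\Big\|^{\frac1{2(p_1+\cdots+p_k)}}.$$ Then the following statements hold. (i) For every Hilbert space $\mathcal H$, the series $$\sum_{(p_1,\dots,p_k)\in\mathbb Z_+^k}\Big\|\sum_{\substack{\alpha_i\in\mathbb F_{n_i}^+,\ |\alpha_i|=p_i\\ i\in\{1,\dots,k\}}}A_{(\alpha)}\otimes X_{(\alpha)}\Big\|,\qquad\mathbf X\in\gamma\mathbf B_{\mathbf n}(\mathcal H),$$ is convergent. Moreover, the convergence is uniform on $r\mathbf B_{\mathbf n}(\mathcal H)^-$ if $0\le r<\gamma$. (ii) For any $s>\gamma$, there is a Hilbert space $\mathcal H$ and $\mathbf Y\in s\mathbf B_{\mathbf n}(\mathcal H)^-$ such that the series $$\sum_{(p_1,\dots,p_k)\in\mathbb Z_+^k}\ \sum_{\substack{\alpha_i\in\mathbb F_{n_i}^+,\ |\alpha_i|=p_i\\ i\in\{1,\dots,k\}}}A_{(\alpha)}\otimes Y_{(\alpha)}$$ is divergent in the operator norm topology.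
   Context: **Polyball.** For a complex Hilbert space $\mathcal H$, $B(\mathcal H)^{n_1}\times_c\cdots\times_c B(\mathcal H)^{n_k}$ is the set of tuples $\mathbf X=(X_1,\dots,X_k)$, $X_i=(X_{i,1},\dots,X_{i,n_i})\in B(\mathcal H)^{n_i}$, such that each entry of $X_s$ commutes with each entry of $X_t$ whenever $s\neq t$ (entries of a single $X_s$ need not commute). Put $\Phi_{X_i}(Y)=\sum_{j=1}^{n_i}X_{i,j}YX_{i,j}^*$ and $\mathbf\Delta_{\mathbf X}=(id-\Phi_{X_1})\circ\cdots\circ(id-\Phi_{X_k})$ on $B(\mathcal H)$. The regular polyball $\mathbf B_{\mathbf n}(\mathcal H)$ is the set of all such $\mathbf X$ with $\|\sum_jX_{i,j}X_{i,j}^*\|<1$ for each $i$ and $\mathbf\Delta_{\mathbf X}(I)>0$ (positive and invertible); $\mathbf B_{\mathbf n}(\mathcal H)^-$ is its operator-norm closure; $r\mathbf B_{\mathbf n}(\mathcal H)=\{r\mathbf X:\mathbf X\in\mathbf B_{\mathbf n}(\mathcal H)\}$, and for $\gamma=\infty$, $\gamma\mathbf B_{\mathbf n}(\mathcal H)=\bigcup_{\rho>0}\rho\mathbf B_{\mathbf n}(\mathcal H)=B(\mathcal H)^{n_1}\times_c\cdots\times_c B(\mathcal H)^{n_k}$. **Power series.** $\mathbb F_{n_i}^+$ is the unital free semigroup on generators $g^i_1,\dots,g^i_{n_i}$, with word length $|\cdot|$. $Z_{i,j}$ are indeterminates, where those with first index $p$ commute with those with first index $q\ne p$ (no relation for equal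 first index). For $\alpha=g^i_{j_1}\cdots g^i_{j_p}$ put $X_{i,\alpha}=X_{i,j_1}\cdots X_{i,j_p}$ ($I$ for the empty word), and for $(\alpha)=(\alpha_1,\dots,\alpha_k)\in\mathbb F_{n_1}^+\times\cdots\times\mathbb F_{n_k}^+$ put $X_{(\alpha)}=X_{1,\alpha_1}\cdots X_{k,\alpha_k}$; similarly $Z_{(\alpha)}$. The sum defining $\varphi$ is over all $(\alpha)$; $\mathcal K$ is a Hilbert space. $\mathbb Z_+$ denotes the nonnegative integers; conventions $1/0=\infty$, $1/\infty=0$. *)

theory Defs
  imports "HOL-Analysis.Analysis"
begin

section \<open>Complex Hilbert spaces\<close>

class scaleC =
  fixes scaleC :: "complex \<Rightarrow> 'a \<Rightarrow> 'a"  (infixr "*\<^sub>C" 75)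

text \<open>
  A complex Hilbert space is a real Hilbert space with a compatible complex structure. The inner
  product \<open>cinner\<close> is linear in its first argument. Positive definiteness and
  \<open>norm x = sqrt (cinner x x)\<close> follow from \<open>inner_eq_Re_cinner\<close> and the axioms of
  \<^class>\<open>real_inner\<close>, as \<open>cinner x x\<close> is real by \<open>cinner_commute\<close>.
\<close>

class chilbert_space = real_inner + banach + scaleC +
  fixes cinner :: "'a \<Rightarrow> 'a \<Rightarrow> complex"
  assumes scaleC_add_right: "c *\<^sub>C (x + y) = c *\<^sub>C x + c *\<^sub>C y"
    and scaleC_add_left: "(c + d) *\<^sub>C x = c *\<^sub>C x + d *\<^sub>C x"
    and scaleC_scaleC: "c *\<^sub>C d *\<^sub>C x = (c * d) *\<^sub>C x"
    and scaleR_eq_scaleC: "r *\<^sub>R x = complex_of_real r *\<^sub>C x"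
    and cinner_commute: "cinner x y = cnj (cinner y x)"
    and cinner_add_left: "cinner (x + y) z = cinner x z + cinner y z"
    and cinner_scaleC_left: "cinner (c *\<^sub>C x) y = c * cinner x y"
    and inner_eq_Re_cinner: "inner x y = Re (cinner x y)"

instantiation complex :: chilbert_space
begin
definition scaleC_complex :: "complex \<Rightarrow> complex \<Rightarrow> complex" where "scaleC_complex = (*)"
definition cinner_complex :: "complex \<Rightarrow> complex \<Rightarrow> complex" where "cinner_complex x y = x * cnj y"
instance
  by standard (auto simp: scaleC_complex_def cinner_complex_def algebra_simps inner_complex_def
      scaleR_conv_of_real)
end

lemma cinner_self: "cinner x x = complex_of_real ((norm x)\<^sup>2)"
proof -
  have "Im (cinner x x) = 0"
    using arg_cong[OF cinner_commute[of x x], of Im] by simp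
  moreover have "Re (cinner x x) = (norm x)\<^sup>2"
    using inner_eq_Re_cinner[of x x] by (simp add: power2_norm_eq_inner)
  ultimately show ?thesis by (simp add: complex_eq_iff)
qed

lemma cinner_add_right: "cinner x (y + z) = cinner x y + cinner x z"
  by (metis cinner_commute cinner_add_left complex_cnj_add)

lemma cinner_scaleC_right: "cinner x (c *\<^sub>C y) = cnj c * cinner x y"
  by (metis cinner_commute cinner_scaleC_left complex_cnj_mult)

lemma scaleC_one [simp]: "1 *\<^sub>C x = (x :: 'a :: chilbert_space)"
  using scaleR_eq_scaleC[of 1 x] by simp

lemma scaleC_zero_left [simp]: "0 *\<^sub>C x = (0 :: 'a :: chilbert_space)"
  using scaleR_eq_scaleC[of 0 x] by simp

lemma scaleC_zero_right [simp]: "c *\<^sub>C 0 = (0 :: 'a :: chilbert_space)"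
  using scaleC_add_right[of c 0 "0 :: 'a"] by simp

lemma cinner_zero_left [simp]: "cinner 0 x = 0"
  using cinner_add_left[of 0 0 x] by simp

lemma cinner_zero_right [simp]: "cinner x 0 = 0"
  using cinner_add_right[of x 0 0] by simp

lemma cinner_minus_left: "cinner (- x) y = - cinner x y"
  by (metis add.right_inverse cinner_add_left cinner_zero_left eq_neg_iff_add_eq_0 add.commute)

lemma cinner_minus_right: "cinner x (- y) = - cinner x y"
  by (metis cinner_commute cinner_minus_left complex_cnj_minus)

lemma cinner_diff_left: "cinner (x - y) z = cinner x z - cinner y z"
  using cinner_add_left[of x "- y" z] by (simp add: cinner_minus_left)

lemma cinner_diff_right: "cinner x (y - z) = cinner x y - cinner x z"
  using cinner_add_right[of x y "- z"] by (simp add: cinner_minus_right)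

lemma cinner_sum_left: "cinner (\<Sum>i\<in>F. f i) y = (\<Sum>i\<in>F. cinner (f i) y)"
  by (induction F rule: infinite_finite_induct) (auto simp: cinner_add_left)

lemma cinner_sum_right: "cinner x (\<Sum>i\<in>F. f i) = (\<Sum>i\<in>F. cinner x (f i))"
  by (induction F rule: infinite_finite_induct) (auto simp: cinner_add_right)

lemma norm_scaleC: "norm (c *\<^sub>C x) = cmod c * norm (x :: 'a :: chilbert_space)"
proof -
  have "complex_of_real ((norm (c *\<^sub>C x))\<^sup>2) = of_real ((cmod c * norm x)\<^sup>2)"
    by (simp only: cinner_self[symmetric] cinner_scaleC_left cinner_scaleC_right)
      (simp add: cinner_self complex_norm_square power_mult_distrib mult.commute del: of_real_power)
  then have "(norm (c *\<^sub>C x))\<^sup>2 = (cmod c * norm x)\<^sup>2"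
    by (simp only: of_real_eq_iff)
  then show ?thesis by (simp add: power2_eq_iff_nonneg)
qed

lemma cinner_Cauchy_Schwarz: "cmod (cinner x y) \<le> norm x * norm y"
proof -
  obtain c where c: "cmod c = 1" "c * cinner x y = of_real (cmod (cinner x y))"
  proof (cases "cinner x y = 0")
    case False
    show ?thesis
      by (rule that[of "cnj (cinner x y) / of_real (cmod (cinner x y))"])
        (use False in \<open>auto simp: norm_divide complex_norm_square power2_eq_square field_simps
          simp flip: complex_norm_square\<close>)
  qed (auto intro: that[of 1])
  have "cmod (cinner x y) = inner (c *\<^sub>C x) y"
    by (simp add: inner_eq_Re_cinner cinner_scaleC_left c)
  also have "\<dots> \<le> norm (c *\<^sub>C x) * norm y" by (rule norm_cauchy_schwarz)
  finally show ?thesis by (simp add: norm_scaleC c)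
qed

lemma cinner_ext: "(\<And>z. cinner x z = cinner y z) \<Longrightarrow> x = y"
proof -
  assume "\<And>z. cinner x z = cinner y z"
  then have "inner (x - y) (x - y) = 0"
    by (simp add: inner_eq_Re_cinner cinner_diff_left)
  then show "x = y" by simp
qed

lemma bounded_linear_cinner_left: "bounded_linear (\<lambda>x. cinner x (y :: 'a :: chilbert_space))"
  by (rule bounded_linear_intro[where K = "norm y"])
    (auto simp: cinner_add_left scaleR_eq_scaleC cinner_scaleC_left cinner_Cauchy_Schwarz
      scaleR_conv_of_real scaleC_complex_def)

lemma bounded_linear_cinner_right: "bounded_linear (\<lambda>y. cinner (x :: 'a :: chilbert_space) y)"
  by (rule bounded_linear_intro[where K = "norm x"])
    (auto simp: cinner_add_right scaleR_eq_scaleC cinner_scaleC_right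
      scaleR_conv_of_real scaleC_complex_def mult.commute[of _ "norm x"] intro: cinner_Cauchy_Schwarz)

section \<open>Square-summable families\<close>

typedef (overloaded) ('i, 'k :: chilbert_space) l2 =
  "{f :: 'i \<Rightarrow> 'k. (\<lambda>i. (norm (f i))\<^sup>2) summable_on UNIV}"
  morphisms l2_apply Abs_l2
  by (rule exI[of _ "\<lambda>_. 0"]) simp

setup_lifting type_definition_l2

lemma l2_summable: "(\<lambda>i. (norm (l2_apply f i))\<^sup>2) summable_on UNIV"
  using l2_apply[of f] by simp

lemma l2_eqI: "(\<And>i. l2_apply f i = l2_apply g i) \<Longrightarrow> f = g"
  by (metis l2_apply_inject ext)

lemma norm_add_sq_le: "(norm (x + y))\<^sup>2 \<le> 2 * (norm x)\<^sup>2 + 2 * (norm (y :: 'a :: real_inner))\<^sup>2"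
proof -
  have "(norm (x + y))\<^sup>2 + (norm (x - y))\<^sup>2 = 2 * (norm x)\<^sup>2 + 2 * (norm y)\<^sup>2"
    by (simp add: power2_norm_eq_inner algebra_simps inner_commute)
  then show ?thesis by (smt (verit) zero_le_power2)
qed

lemma sq_summable_add:
  fixes f g :: "'i \<Rightarrow> 'k :: chilbert_space"
  assumes "(\<lambda>i. (norm (f i))\<^sup>2) summable_on S" "(\<lambda>i. (norm (g i))\<^sup>2) summable_on S"
  shows "(\<lambda>i. (norm (f i + g i))\<^sup>2) summable_on S"
  by (rule summable_on_comparison_test[of "\<lambda>i. 2 * (norm (f i))\<^sup>2 + 2 * (norm (g i))\<^sup>2"])
    (auto intro!: summable_on_add summable_on_cmult_right assms norm_add_sq_le)

lemma sq_summable_scaleC: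
  fixes f :: "'i \<Rightarrow> 'k :: chilbert_space"
  assumes "(\<lambda>i. (norm (f i))\<^sup>2) summable_on S"
  shows "(\<lambda>i. (norm (c *\<^sub>C f i))\<^sup>2) summable_on S"
  using summable_on_cmult_right[OF assms, of "(cmod c)\<^sup>2"]
  by (simp add: norm_scaleC power_mult_distrib)

lemma sq_summable_scaleR:
  fixes f :: "'i \<Rightarrow> 'k :: chilbert_space"
  assumes "(\<lambda>i. (norm (f i))\<^sup>2) summable_on S"
  shows "(\<lambda>i. (norm (r *\<^sub>R f i))\<^sup>2) summable_on S"
  using sq_summable_scaleC[OF assms] by (simp add: scaleR_eq_scaleC)

lemma cinner_summable:
  fixes f g :: "'i \<Rightarrow> 'k :: chilbert_space"
  assumes "(\<lambda>i. (norm (f i))\<^sup>2) summable_on S" "(\<lambda>i. (norm (g i))\<^sup>2) summable_on S"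
  shows "(\<lambda>i. cinner (f i) (g i)) summable_on S"
proof (rule abs_summable_summable, rule summable_on_comparison_test)
  show "(\<lambda>i. (norm (f i))\<^sup>2 + (norm (g i))\<^sup>2) summable_on S"
    using assms by (rule summable_on_add)
  show "cmod (cinner (f i) (g i)) \<le> (norm (f i))\<^sup>2 + (norm (g i))\<^sup>2" for i
  proof -
    have "0 \<le> (norm (f i) - norm (g i))\<^sup>2" "0 \<le> norm (f i) * norm (g i)" by simp_all
    then show ?thesis
      using cinner_Cauchy_Schwarz[of "f i" "g i"] unfolding power2_diff by linarith
  qed
qed auto

instantiation l2 :: (type, chilbert_space) real_inner
begin

lift_definition zero_l2 :: "('a, 'b) l2" is "\<lambda>_. 0" by simp
lift_definition plus_l2 :: "('a, 'b) l2 \<Rightarrow> ('a, 'b) l2 \<Rightarrow> ('a, 'b) l2" is "\<lambda>f g i. f i + g i"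
  by (rule sq_summable_add)
lift_definition uminus_l2 :: "('a, 'b) l2 \<Rightarrow> ('a, 'b) l2" is "\<lambda>f i. - f i" by simp
lift_definition minus_l2 :: "('a, 'b) l2 \<Rightarrow> ('a, 'b) l2 \<Rightarrow> ('a, 'b) l2" is "\<lambda>f g i. f i - g i"
  subgoal for f g using sq_summable_add[of f UNIV "\<lambda>i. - g i"] by simp
  done
lift_definition scaleR_l2 :: "real \<Rightarrow> ('a, 'b) l2 \<Rightarrow> ('a, 'b) l2" is "\<lambda>r f i. r *\<^sub>R f i"
  by (rule sq_summable_scaleR)
definition inner_l2 :: "('a, 'b) l2 \<Rightarrow> ('a, 'b) l2 \<Rightarrow> real" where
  "inner_l2 f g = Re (\<Sum>\<^sub>\<infinity>i. cinner (l2_apply f i) (l2_apply g i))"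
definition norm_l2 :: "('a, 'b) l2 \<Rightarrow> real" where
  "norm_l2 f = sqrt (inner f f)"
definition dist_l2 :: "('a, 'b) l2 \<Rightarrow> ('a, 'b) l2 \<Rightarrow> real" where
  "dist_l2 f g = norm (f - g)"
definition sgn_l2 :: "('a, 'b) l2 \<Rightarrow> ('a, 'b) l2" where
  "sgn_l2 f = scaleR (inverse (norm f)) f"
definition uniformity_l2 :: "(('a, 'b) l2 \<times> ('a, 'b) l2) filter" where
  "uniformity_l2 = (INF e\<in>{0<..}. principal {(x, y). dist x y < e})"
definition open_l2 :: "('a, 'b) l2 set \<Rightarrow> bool" where
  "open_l2 U = (\<forall>x\<in>U. \<forall>\<^sub>F (x', y) in uniformity. x' = x \<longrightarrow> y \<in> U)"

lemmas l2_apply_simps [simp] =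
  zero_l2.rep_eq plus_l2.rep_eq uminus_l2.rep_eq minus_l2.rep_eq scaleR_l2.rep_eq

lemma inner_l2_self: "inner f f = (\<Sum>\<^sub>\<infinity>i. (norm (l2_apply f i))\<^sup>2)" for f :: "('a, 'b) l2"
  by (simp add: inner_l2_def cinner_self infsum_Re[symmetric]
      summable_on_of_real l2_summable del: of_real_power)

instance proof
  fix f g h :: "('a, 'b) l2" and r s :: real
  show "f + g + h = f + (g + h)" "f + g = g + f" "0 + f = f" "- f + f = 0" "f - g = f + - g"
    by (auto intro!: l2_eqI simp: algebra_simps)
  show "r *\<^sub>R (f + g) = r *\<^sub>R f + r *\<^sub>R g" "(r + s) *\<^sub>R f = r *\<^sub>R f + s *\<^sub>R f"
    "r *\<^sub>R s *\<^sub>R f = (r * s) *\<^sub>R f" "1 *\<^sub>R f = f"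
    by (auto intro!: l2_eqI simp: algebra_simps)
  show "dist f g = norm (f - g)" "sgn f = scaleR (inverse (norm f)) f"
    "uniformity = (INF e\<in>{0<..}. principal {(x :: ('a, 'b) l2, y). dist x y < e})"
    by (rule dist_l2_def sgn_l2_def uniformity_l2_def)+
  show "open U = (\<forall>x\<in>U. \<forall>\<^sub>F (x', y) in uniformity. x' = x \<longrightarrow> y \<in> U)" for U :: "('a, 'b) l2 set"
    by (rule open_l2_def)
  show "inner f g = inner g f"
  proof -
    have "(\<Sum>\<^sub>\<infinity>i. cinner (l2_apply f i) (l2_apply g i)) = cnj (\<Sum>\<^sub>\<infinity>i. cinner (l2_apply g i) (l2_apply f i))"
      unfolding infsum_cnj[symmetric] by (rule infsum_cong) (rule cinner_commute)
    then show ?thesis by (simp add: inner_l2_def)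
  qed
  show "inner (f + g) h = inner f h + inner g h"
    by (simp add: inner_l2_def cinner_add_left infsum_add cinner_summable l2_summable)
  show "inner (r *\<^sub>R f) g = r * inner f g"
    by (simp add: inner_l2_def scaleR_eq_scaleC cinner_scaleC_left infsum_cmult_right')
  show "0 \<le> inner f f"
    by (simp add: inner_l2_self infsum_nonneg)
  show "(inner f f = 0) = (f = 0)"
  proof
    assume "inner f f = 0"
    then have "(norm (l2_apply f i))\<^sup>2 \<le> 0" for i
      using finite_sum_le_infsum[OF l2_summable[of f], of "{i}"] by (simp add: inner_l2_self)
    then show "f = 0" by (auto intro: l2_eqI)
  qed (simp add: inner_l2_self)
  show "norm f = sqrt (inner f f)" by (rule norm_l2_def)
qed

end

instance l2 :: (type, chilbert_space) banach
proof
  fix X :: "nat \<Rightarrow> ('a, 'b) l2"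
  assume X: "Cauchy X"
  have nrm: "norm f = sqrt (\<Sum>\<^sub>\<infinity>i. (norm (l2_apply f i))\<^sup>2)" for f :: "('a, 'b) l2"
    by (simp add: norm_eq_sqrt_inner inner_l2_self)
  have nrm_sq: "(norm f)\<^sup>2 = (\<Sum>\<^sub>\<infinity>i. (norm (l2_apply f i))\<^sup>2)" for f :: "('a, 'b) l2"
    by (simp add: nrm infsum_nonneg)
  have part: "(\<Sum>i\<in>F. (norm (l2_apply f i))\<^sup>2) \<le> (norm f)\<^sup>2" if "finite F"
    for f :: "('a, 'b) l2" and F
    unfolding nrm_sq using that by (intro finite_sum_le_infsum l2_summable) auto
  have comp: "norm (l2_apply f i) \<le> norm f" for f :: "('a, 'b) l2" and i
  proof (rule power2_le_imp_le)
    show "(norm (l2_apply f i))\<^sup>2 \<le> (norm f)\<^sup>2" using part[of "{i}" f] by simp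
    show "0 \<le> norm f" by (simp add: nrm infsum_nonneg)
  qed
  have CX: "\<exists>M. \<forall>m\<ge>M. \<forall>n\<ge>M. norm (X m - X n) < e" if "e > 0" for e
    using X that unfolding Cauchy_def dist_norm by blast
  have C: "Cauchy (\<lambda>n. l2_apply (X n) i)" for i
  proof (rule CauchyI)
    fix e :: real assume "e > 0"
    then obtain M where "\<forall>m\<ge>M. \<forall>n\<ge>M. norm (X m - X n) < e" using CX by blast
    then show "\<exists>M. \<forall>m\<ge>M. \<forall>n\<ge>M. norm (l2_apply (X m) i - l2_apply (X n) i) < e"
      using le_less_trans[OF comp[of "X _ - X _" i]]
      by (intro exI[of _ M]) (simp only: minus_l2.rep_eq, blast)
  qed
  define g where "g i = lim (\<lambda>n. l2_apply (X n) i)" for i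
  have g: "(\<lambda>n. l2_apply (X n) i) \<longlonglongrightarrow> g i" for i
    unfolding g_def by (rule convergent_LIMSEQ_iff[THEN iffD1, OF Cauchy_convergent[OF C]])
  have lim: "(\<Sum>i\<in>F. (norm (l2_apply (X m) i - g i))\<^sup>2) \<le> e\<^sup>2"
    if "finite F" "\<forall>n\<ge>M. norm (X m - X n) < e" for F m M e
  proof (rule tendsto_upperbound)
    show "(\<lambda>n. \<Sum>i\<in>F. (norm (l2_apply (X m) i - l2_apply (X n) i))\<^sup>2)
        \<longlonglongrightarrow> (\<Sum>i\<in>F. (norm (l2_apply (X m) i - g i))\<^sup>2)"
      by (intro tendsto_intros g)
    show "\<forall>\<^sub>F n in sequentially. (\<Sum>i\<in>F. (norm (l2_apply (X m) i - l2_apply (X n) i))\<^sup>2) \<le> e\<^sup>2"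
    proof (rule eventually_sequentiallyI[of M])
      fix n assume "n \<ge> M"
      have "(norm (X m - X n))\<^sup>2 \<le> e\<^sup>2"
        using that(2) \<open>n \<ge> M\<close> by (intro power_mono) (auto simp: nrm infsum_nonneg less_imp_le)
      then show "(\<Sum>i\<in>F. (norm (l2_apply (X m) i - l2_apply (X n) i))\<^sup>2) \<le> e\<^sup>2"
        using part[OF that(1), of "X m - X n"] by simp
    qed
  qed simp
  have summ: "(\<lambda>i. (norm (l2_apply (X m) i - g i))\<^sup>2) summable_on UNIV"
    and bnd: "(\<Sum>\<^sub>\<infinity>i. (norm (l2_apply (X m) i - g i))\<^sup>2) \<le> e\<^sup>2"
    if "\<forall>n\<ge>M. norm (X m - X n) < e" for m M e
  proof -
    show s: "(\<lambda>i. (norm (l2_apply (X m) i - g i))\<^sup>2) summable_on UNIV"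
      by (rule nonneg_bdd_above_summable_on) (use lim[OF _ that] in \<open>auto intro!: bdd_aboveI2\<close>)
    show "(\<Sum>\<^sub>\<infinity>i. (norm (l2_apply (X m) i - g i))\<^sup>2) \<le> e\<^sup>2"
      by (rule infsum_le_finite_sums[OF s]) (use lim[OF _ that] in auto)
  qed
  obtain M1 where "\<forall>n\<ge>M1. norm (X M1 - X n) < 1" using CX[of 1] by auto
  from summ[OF this] have "(\<lambda>i. (norm (g i - l2_apply (X M1) i))\<^sup>2) summable_on UNIV"
    by (simp add: norm_minus_commute)
  from sq_summable_add[OF this l2_summable[of "X M1"]]
  have gs: "(\<lambda>i. (norm (g i))\<^sup>2) summable_on UNIV" by simp
  define G where "G = Abs_l2 g"
  have G: "l2_apply G = g" unfolding G_def using gs by (simp add: Abs_l2_inverse)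
  have "\<exists>M. \<forall>m\<ge>M. norm (X m - G) < e" if "e > 0" for e
  proof -
    obtain M where M: "\<forall>m\<ge>M. \<forall>n\<ge>M. norm (X m - X n) < e / 2" using CX[of "e/2"] \<open>e > 0\<close> by auto
    have "norm (X m - G) < e" if "m \<ge> M" for m
    proof -
      have "\<forall>n\<ge>M. norm (X m - X n) < e / 2" using M that by blast
      from bnd[OF this] have "(norm (X m - G))\<^sup>2 \<le> (e / 2)\<^sup>2"
        unfolding nrm_sq by (simp only: minus_l2.rep_eq G)
      then have "norm (X m - G) \<le> e / 2"
        by (rule power2_le_imp_le) (use \<open>e > 0\<close> in simp)
      then show ?thesis using \<open>e > 0\<close> by simp
    qed
    then show ?thesis by blast
  qed
  then have "X \<longlonglongrightarrow> G"
    unfolding lim_sequentially dist_norm by (meson)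
  then show "convergent X" by (auto simp: convergent_def)
qed

instantiation l2 :: (type, chilbert_space) chilbert_space
begin

lift_definition scaleC_l2 :: "complex \<Rightarrow> ('a, 'b) l2 \<Rightarrow> ('a, 'b) l2" is "\<lambda>c f i. c *\<^sub>C f i"
  by (rule sq_summable_scaleC)
definition cinner_l2 :: "('a, 'b) l2 \<Rightarrow> ('a, 'b) l2 \<Rightarrow> complex" where
  "cinner_l2 f g = (\<Sum>\<^sub>\<infinity>i. cinner (l2_apply f i) (l2_apply g i))"

declare scaleC_l2.rep_eq [simp]

instance proof
  fix f g h :: "('a, 'b) l2" and r :: real and c d :: complex
  show "c *\<^sub>C (f + g) = c *\<^sub>C f + c *\<^sub>C g" "(c + d) *\<^sub>C f = c *\<^sub>C f + d *\<^sub>C f"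
    "c *\<^sub>C d *\<^sub>C f = (c * d) *\<^sub>C f" "r *\<^sub>R f = complex_of_real r *\<^sub>C f"
    by (auto intro!: l2_eqI
        simp: scaleC_add_right scaleC_add_left scaleC_scaleC scaleR_eq_scaleC)
  show "cinner f g = cnj (cinner g f)"
    unfolding cinner_l2_def by (subst infsum_cnj[symmetric]) (rule infsum_cong, rule cinner_commute)
  show "cinner (f + g) h = cinner f h + cinner g h"
    by (simp add: cinner_l2_def cinner_add_left infsum_add cinner_summable l2_summable)
  show "cinner (c *\<^sub>C f) g = c * cinner f g"
    by (simp add: cinner_l2_def cinner_scaleC_left infsum_cmult_right')
  show "inner f g = Re (cinner f g)"
    by (simp add: inner_l2_def cinner_l2_def)
qed

end

section \<open>Orthonormal bases\<close>

definition orthonormal :: "'a :: chilbert_space set \<Rightarrow> bool" where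
  "orthonormal B \<longleftrightarrow> (\<forall>x\<in>B. \<forall>y\<in>B. cinner x y = (if x = y then 1 else 0))"

definition orthonormal_basis :: "'a :: chilbert_space set \<Rightarrow> bool" where
  "orthonormal_basis B \<longleftrightarrow> orthonormal B \<and> (\<forall>x. (\<forall>b\<in>B. cinner x b = 0) \<longrightarrow> x = 0)"

lemma orthonormal_basis_exists: "\<exists>B :: 'a :: chilbert_space set. orthonormal_basis B"
proof -
  have "\<exists>M\<in>{B. orthonormal B}. \<forall>X\<in>{B :: 'a set. orthonormal B}. M \<subseteq> X \<longrightarrow> X = M"
  proof (rule subset_Zorn')
    fix C assume C: "subset.chain {B :: 'a set. orthonormal B} C"
    have "cinner x y = (if x = y then 1 else 0)" if "x \<in> \<Union>C" "y \<in> \<Union>C" for x y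
    proof -
      from that obtain X Y where XY: "X \<in> C" "Y \<in> C" "x \<in> X" "y \<in> Y" by blast
      with C have "X \<subseteq> Y \<or> Y \<subseteq> X" "orthonormal X" "orthonormal Y"
        unfolding subset.chain_def by blast+
      with XY show ?thesis unfolding orthonormal_def by blast
    qed
    then show "\<Union>C \<in> {B. orthonormal B}" by (auto simp: orthonormal_def)
  qed
  then obtain M :: "'a set" where M: "orthonormal M" "\<And>X. orthonormal X \<Longrightarrow> M \<subseteq> X \<Longrightarrow> X = M"
    by auto
  have "x = 0" if x: "\<forall>b\<in>M. cinner x b = 0" for x
  proof (rule ccontr)
    assume "x \<noteq> 0"
    define u where "u = complex_of_real (inverse (norm x)) *\<^sub>C x"
    have uu: "cinner u u = 1"
      using \<open>x \<noteq> 0\<close> by (simp add: u_def cinner_self norm_scaleC norm_inverse)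
    have ub: "cinner u b = 0" if "b \<in> M" for b
      using x that by (simp add: u_def cinner_scaleC_left)
    then have bu: "cinner b u = 0" if "b \<in> M" for b
      using that by (subst cinner_commute) simp
    have "orthonormal (insert u M)"
      using M(1) uu ub bu unfolding orthonormal_def by auto
    then have "u \<in> M" using M(2)[of "insert u M"] by blast
    then show False using ub[of u] uu by simp
  qed
  with M(1) show ?thesis unfolding orthonormal_basis_def by blast
qed

lemma norm_sum_orthonormal:
  assumes "orthonormal B" "finite F" "F \<subseteq> B"
  shows "(norm (\<Sum>b\<in>F. c b *\<^sub>C b))\<^sup>2 = (\<Sum>b\<in>F. (cmod (c b))\<^sup>2)"
proof -
  have "complex_of_real ((norm (\<Sum>b\<in>F. c b *\<^sub>C b))\<^sup>2)
      = (\<Sum>b\<in>F. \<Sum>d\<in>F. c b * (cnj (c d) * cinner b d))"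
    unfolding cinner_self[symmetric]
    by (simp only: cinner_sum_left cinner_scaleC_left)
      (simp add: cinner_sum_right cinner_scaleC_right sum_distrib_left)
  also have "\<dots> = (\<Sum>b\<in>F. \<Sum>d\<in>F. if b = d then c b * cnj (c d) else 0)"
    using assms unfolding orthonormal_def by (intro sum.cong refl) (auto simp: subset_iff)
  also have "\<dots> = (\<Sum>b\<in>F. c b * cnj (c b))"
    using assms(2) by simp
  also have "\<dots> = complex_of_real (\<Sum>b\<in>F. (cmod (c b))\<^sup>2)"
    by (simp add: complex_norm_square del: of_real_power)
  finally show ?thesis by (simp only: of_real_eq_iff)
qed

lemma Bessel_finite:
  assumes "orthonormal B" "finite F" "F \<subseteq> B"
  shows "(\<Sum>b\<in>F. (cmod (cinner x b))\<^sup>2) \<le> (norm x)\<^sup>2"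
proof -
  define y where "y = (\<Sum>b\<in>F. cinner x b *\<^sub>C b)"
  have yy: "(norm y)\<^sup>2 = (\<Sum>b\<in>F. (cmod (cinner x b))\<^sup>2)"
    unfolding y_def by (rule norm_sum_orthonormal[OF assms])
  have "cinner x y = complex_of_real (\<Sum>b\<in>F. (cmod (cinner x b))\<^sup>2)"
    by (simp add: y_def cinner_sum_right cinner_scaleC_right complex_norm_square mult.commute
        del: of_real_power)
  then have xy: "inner x y = (norm y)\<^sup>2" by (simp add: inner_eq_Re_cinner yy)
  have "0 \<le> (norm (x - y))\<^sup>2" by simp
  also have "\<dots> = (norm x)\<^sup>2 - (norm y)\<^sup>2"
    using xy by (simp add: power2_norm_eq_inner algebra_simps inner_commute)
  finally show ?thesis by (simp add: yy)
qed

lemma orthonormal_summable: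
  fixes c :: "'a :: chilbert_space \<Rightarrow> complex"
  assumes on: "orthonormal B" and "(\<lambda>b. (cmod (c b))\<^sup>2) summable_on B"
  shows "(\<lambda>b. c b *\<^sub>C b) summable_on B"
proof -
  define a where "a b = (cmod (c b))\<^sup>2" for b
  have "a summable_on B" using assms(2) unfolding a_def[abs_def] .
  then have ta: "(sum a \<longlongrightarrow> infsum a B) (finite_subsets_at_top B)"
    using has_sum_def has_sum_infsum by blast
  have cs: "cauchy_filter (filtermap (sum (\<lambda>b. c b *\<^sub>C b)) (finite_subsets_at_top B))"
    unfolding cauchy_filter_metric_filtermap
  proof (intro allI impI)
    fix e :: real assume "e > 0"
    then have "(e / 2)\<^sup>2 / 2 > 0" by simp
    from tendstoD[OF ta this] have "\<exists>H. finite H \<and> H \<subseteq> B \<and> (\<forall>F. finite F \<and> H \<subseteq> F \<and> F \<subseteq> B \<longrightarrow>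
        dist (sum a F) (infsum a B) < (e / 2)\<^sup>2 / 2)"
      unfolding eventually_finite_subsets_at_top .
    then obtain H where H': "finite H \<and> H \<subseteq> B \<and> (\<forall>F. finite F \<and> H \<subseteq> F \<and> F \<subseteq> B \<longrightarrow>
        dist (sum a F) (infsum a B) < (e / 2)\<^sup>2 / 2)" ..
    then have H: "finite H" "H \<subseteq> B" by simp_all
    have PH: "dist (sum a F) (infsum a B) < (e / 2)\<^sup>2 / 2" if "finite F" "H \<subseteq> F" "F \<subseteq> B" for F
      using H' that by simp
    define Q where "Q F \<longleftrightarrow> finite F \<and> H \<subseteq> F \<and> F \<subseteq> B" for F
    have near: "dist (\<Sum>b\<in>F. c b *\<^sub>C b) (\<Sum>b\<in>H. c b *\<^sub>C b) < e / 2" if "Q F" for F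
    proof -
      have F: "finite F" "H \<subseteq> F" "F \<subseteq> B" using that by (auto simp: Q_def)
      have "(dist (\<Sum>b\<in>F. c b *\<^sub>C b) (\<Sum>b\<in>H. c b *\<^sub>C b))\<^sup>2
          = (norm (\<Sum>b\<in>F - H. c b *\<^sub>C b))\<^sup>2"
        using F by (simp add: dist_norm sum_diff)
      also have "\<dots> = sum a (F - H)"
        unfolding a_def by (rule norm_sum_orthonormal[OF on]) (use F in auto)
      also have "\<dots> = sum a F - sum a H" using F by (simp add: sum_diff)
      also have "\<dots> \<le> dist (sum a F) (sum a H)" by (simp add: dist_real_def)
      also have "\<dots> < (e / 2)\<^sup>2" by (rule dist_triangle_half_l[OF PH[OF F] PH[OF H(1) subset_refl H(2)]])
      finally show ?thesis by (rule power2_less_imp_less) (use \<open>e > 0\<close> in simp)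
    qed
    have "dist (\<Sum>b\<in>F. c b *\<^sub>C b) (\<Sum>b\<in>G. c b *\<^sub>C b) < e" if "Q F" "Q G" for F G
      using near[OF that(1)] near[OF that(2)] by (rule dist_triangle_half_l)
    moreover have "eventually Q (finite_subsets_at_top B)"
      unfolding eventually_finite_subsets_at_top Q_def by (intro exI[of _ H]) (simp add: H)
    ultimately show "\<exists>P. eventually P (finite_subsets_at_top B) \<and>
        (\<forall>F G. P F \<and> P G \<longrightarrow>
          dist (\<Sum>b\<in>F. c b *\<^sub>C b) (\<Sum>b\<in>G. c b *\<^sub>C b) < e)"
      by (intro exI[of _ Q]) simp
  qed
  have "complete (UNIV :: 'a set)"
    by (meson Cauchy_convergent UNIV_I complete_def convergent_def)
  with cs obtain y where "(sum (\<lambda>b. c b *\<^sub>C b) \<longlongrightarrow> y) (finite_subsets_at_top B)"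
    using complete_uniform[where S=UNIV] by (force simp add: filterlim_def)
  then show ?thesis by (auto simp: has_sum_def summable_on_def)
qed

lemma orthonormal_basis_expansion:
  assumes B: "orthonormal_basis B"
  shows "((\<lambda>b. cinner x b *\<^sub>C b) has_sum x) B"
proof -
  have on: "orthonormal B" using B by (simp add: orthonormal_basis_def)
  have "(\<lambda>b. (cmod (cinner x b))\<^sup>2) summable_on B"
    by (rule nonneg_bdd_above_summable_on)
      (use Bessel_finite[OF on, of _ x] in \<open>auto intro!: bdd_aboveI2\<close>)
  from orthonormal_summable[OF on this]
  obtain y where y: "((\<lambda>b. cinner x b *\<^sub>C b) has_sum y) B"
    unfolding summable_on_def ..
  have "cinner (x - y) d = 0" if d: "d \<in> B" for d
  proof -
    have "((\<lambda>b. cinner (cinner x b *\<^sub>C b) d) has_sum cinner y d) B"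
      by (rule has_sum_bounded_linear[OF bounded_linear_cinner_left y])
    also have "?this \<longleftrightarrow> ((\<lambda>b. if b = d then cinner x d else 0) has_sum cinner y d) B"
      using on d by (intro has_sum_cong) (auto simp: cinner_scaleC_left orthonormal_def)
    also have "\<dots> \<longleftrightarrow> ((\<lambda>b. cinner x d) has_sum cinner y d) {d}"
      using d by (intro has_sum_cong_neutral) auto
    finally have "cinner y d = cinner x d"
      by (metis has_sum_finite has_sum_unique finite.emptyI finite_insert sum.insert sum.empty
          empty_iff add_0_right)
    then show ?thesis by (simp add: cinner_diff_left)
  qed
  then have "x - y = 0" using B unfolding orthonormal_basis_def by blast
  with y show ?thesis by simp
qed

lemma Parseval:
  assumes B: "orthonormal_basis B"
  shows "((\<lambda>b. cinner x b * cinner b y) has_sum cinner x y) B"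
  using has_sum_bounded_linear[OF bounded_linear_cinner_left orthonormal_basis_expansion[OF B]]
  by (simp add: cinner_scaleC_left)

lemma Parseval_norm:
  assumes B: "orthonormal_basis B"
  shows "((\<lambda>b. (cmod (cinner x b))\<^sup>2) has_sum (norm x)\<^sup>2) B"
proof -
  have "cinner x b * cinner b x = complex_of_real ((cmod (cinner x b))\<^sup>2)" for b
    by (subst (2) cinner_commute) (simp add: complex_norm_square del: of_real_power)
  then show ?thesis
    using has_sum_Re[OF Parseval[OF B, of x x]] by (simp add: cinner_self del: of_real_power)
qed

section \<open>Hilbert space tensor products\<close>

definition basis :: "'a :: chilbert_space set" where
  "basis = (SOME B. orthonormal_basis B)"

lemma orthonormal_basis_basis: "orthonormal_basis (basis :: 'a :: chilbert_space set)"
  unfolding basis_def by (rule someI_ex[OF orthonormal_basis_exists])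

text \<open>
  The tensor product of \<open>'k\<close> and \<open>'h\<close> is realized as the \<open>l2\<close>-direct sum of copies of \<open>'k\<close>, one
  for each element \<open>b\<close> of an orthonormal basis of \<open>'h\<close>; the copy at \<open>b\<close> is the subspace of the
  tensors \<open>x \<otimes> b\<close>. The lemmas \<open>cinner_tensor\<close> and \<open>tensor_total\<close> below characterize it up to a
  unitary operator.
\<close>

typedef (overloaded) ('k :: chilbert_space, 'h :: chilbert_space) tensor_product =
  "{f :: ('h, 'k) l2. \<forall>b. b \<notin> basis \<longrightarrow> l2_apply f b = 0}"
  morphisms tensor_rep Abs_tensor
  by (rule exI[of _ 0]) simp

setup_lifting type_definition_tensor_product

instantiation tensor_product :: (chilbert_space, chilbert_space) real_inner
begin

lift_definition zero_tensor_product :: "('a, 'b) tensor_product" is 0 by simp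
lift_definition plus_tensor_product ::
  "('a, 'b) tensor_product \<Rightarrow> ('a, 'b) tensor_product \<Rightarrow> ('a, 'b) tensor_product" is "(+)" by simp
lift_definition uminus_tensor_product ::
  "('a, 'b) tensor_product \<Rightarrow> ('a, 'b) tensor_product" is uminus by simp
lift_definition minus_tensor_product ::
  "('a, 'b) tensor_product \<Rightarrow> ('a, 'b) tensor_product \<Rightarrow> ('a, 'b) tensor_product" is "(-)" by simp
lift_definition scaleR_tensor_product ::
  "real \<Rightarrow> ('a, 'b) tensor_product \<Rightarrow> ('a, 'b) tensor_product" is scaleR by simp
lift_definition inner_tensor_product ::
  "('a, 'b) tensor_product \<Rightarrow> ('a, 'b) tensor_product \<Rightarrow> real" is inner .
lift_definition norm_tensor_product :: "('a, 'b) tensor_product \<Rightarrow> real" is norm .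
definition dist_tensor_product ::
  "('a, 'b) tensor_product \<Rightarrow> ('a, 'b) tensor_product \<Rightarrow> real" where
  "dist_tensor_product s t = norm (s - t)"
definition sgn_tensor_product :: "('a, 'b) tensor_product \<Rightarrow> ('a, 'b) tensor_product" where
  "sgn_tensor_product t = scaleR (inverse (norm t)) t"
definition uniformity_tensor_product ::
  "(('a, 'b) tensor_product \<times> ('a, 'b) tensor_product) filter" where
  "uniformity_tensor_product = (INF e\<in>{0<..}. principal {(s, t). dist s t < e})"
definition open_tensor_product :: "('a, 'b) tensor_product set \<Rightarrow> bool" where
  "open_tensor_product U = (\<forall>s\<in>U. \<forall>\<^sub>F (s', t) in uniformity. s' = s \<longrightarrow> t \<in> U)"

instance
proof
  fix s t u :: "('a, 'b) tensor_product" and p q :: real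
  show "s + t + u = s + (t + u)" "s + t = t + s" "0 + s = s" "- s + s = 0" "s - t = s + - t"
    by (transfer, simp add: algebra_simps)+
  show "p *\<^sub>R (s + t) = p *\<^sub>R s + p *\<^sub>R t" "(p + q) *\<^sub>R s = p *\<^sub>R s + q *\<^sub>R s"
    "p *\<^sub>R q *\<^sub>R s = (p * q) *\<^sub>R s" "1 *\<^sub>R s = s"
    by (transfer, simp add: algebra_simps)+
  show "dist s t = norm (s - t)" "sgn s = scaleR (inverse (norm s)) s"
    "uniformity = (INF e\<in>{0<..}. principal {(s :: ('a, 'b) tensor_product, t). dist s t < e})"
    by (rule dist_tensor_product_def sgn_tensor_product_def uniformity_tensor_product_def)+
  show "open U = (\<forall>s\<in>U. \<forall>\<^sub>F (s', t) in uniformity. s' = s \<longrightarrow> t \<in> U)"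
    for U :: "('a, 'b) tensor_product set"
    by (rule open_tensor_product_def)
  show "inner s t = inner t s" by transfer (rule inner_commute)
  show "inner (s + t) u = inner s u + inner t u" by transfer (rule inner_add_left)
  show "inner (p *\<^sub>R s) t = p * inner s t" by transfer simp
  show "0 \<le> inner s s" by transfer simp
  show "(inner s s = 0) = (s = 0)" by transfer simp
  show "norm s = sqrt (inner s s)" by transfer (rule norm_eq_sqrt_inner)
qed

end

instance tensor_product :: (chilbert_space, chilbert_space) banach
proof
  fix X :: "nat \<Rightarrow> ('a, 'b) tensor_product"
  assume X: "Cauchy X"
  have d: "dist (tensor_rep s) (tensor_rep t) = dist s t" for s t :: "('a, 'b) tensor_product"
    by (simp add: dist_norm norm_tensor_product.rep_eq minus_tensor_product.rep_eq)
  have "Cauchy (\<lambda>n. tensor_rep (X n))"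
    using X unfolding Cauchy_def d .
  then obtain f where f: "(\<lambda>n. tensor_rep (X n)) \<longlonglongrightarrow> f"
    using Cauchy_convergent convergent_def by blast
  have comp: "norm (l2_apply g i) \<le> norm g" for g :: "('b, 'a) l2" and i
  proof (rule power2_le_imp_le)
    show "(norm (l2_apply g i))\<^sup>2 \<le> (norm g)\<^sup>2"
      using finite_sum_le_infsum[OF l2_summable[of g], of "{i}"]
      by (simp add: power2_norm_eq_inner[of g] inner_l2_self)
  qed simp
  have "l2_apply f b = 0" if b: "b \<notin> basis" for b
  proof -
    have "norm (l2_apply f b) \<le> norm (f - tensor_rep (X n))" for n
      using comp[of "f - tensor_rep (X n)" b] tensor_rep[of "X n"] b by simp
    moreover have "(\<lambda>n. norm (f - tensor_rep (X n))) \<longlonglongrightarrow> 0"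
      using tendsto_norm[OF tendsto_diff[OF tendsto_const f, of f]] by simp
    ultimately have "norm (l2_apply f b) \<le> 0"
      by (intro tendsto_lowerbound[of _ 0 sequentially]) (auto intro!: always_eventually)
    then show ?thesis by simp
  qed
  then have r: "tensor_rep (Abs_tensor f) = f" by (simp add: Abs_tensor_inverse)
  have "X \<longlonglongrightarrow> Abs_tensor f"
    using f unfolding lim_sequentially d[symmetric] r .
  then show "convergent X" by (auto simp: convergent_def)
qed

instantiation tensor_product :: (chilbert_space, chilbert_space) chilbert_space
begin

lift_definition scaleC_tensor_product ::
  "complex \<Rightarrow> ('a, 'b) tensor_product \<Rightarrow> ('a, 'b) tensor_product" is scaleC by simp
lift_definition cinner_tensor_product ::
  "('a, 'b) tensor_product \<Rightarrow> ('a, 'b) tensor_product \<Rightarrow> complex" is cinner .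

instance
proof
  fix s t u :: "('a, 'b) tensor_product" and r :: real and c d :: complex
  show "c *\<^sub>C (s + t) = c *\<^sub>C s + c *\<^sub>C t" by transfer (rule scaleC_add_right)
  show "(c + d) *\<^sub>C s = c *\<^sub>C s + d *\<^sub>C s" by transfer (rule scaleC_add_left)
  show "c *\<^sub>C d *\<^sub>C s = (c * d) *\<^sub>C s" by transfer (rule scaleC_scaleC)
  show "r *\<^sub>R s = complex_of_real r *\<^sub>C s" by transfer (rule scaleR_eq_scaleC)
  show "cinner s t = cnj (cinner t s)" by transfer (rule cinner_commute)
  show "cinner (s + t) u = cinner s u + cinner t u" by transfer (rule cinner_add_left)
  show "cinner (c *\<^sub>C s) t = c * cinner s t" by transfer (rule cinner_scaleC_left)
  show "inner s t = Re (cinner s t)" by transfer (rule inner_eq_Re_cinner)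
qed

end

lemma sq_summable_tensor:
  fixes x :: "'k :: chilbert_space" and y :: "'h :: chilbert_space"
  shows "(\<lambda>b. (norm (if b \<in> basis then cinner y b *\<^sub>C x else 0))\<^sup>2) summable_on UNIV"
proof -
  have "(\<lambda>b. (cmod (cinner y b))\<^sup>2 * (norm x)\<^sup>2) summable_on basis"
    by (intro summable_on_cmult_left has_sum_imp_summable[OF Parseval_norm[OF orthonormal_basis_basis]])
  then show ?thesis
    by (rule summable_on_cong_neutral[THEN iffD1, rotated -1])
      (auto simp: norm_scaleC power_mult_distrib)
qed

text \<open>The elementary tensor \<open>x \<otimes> y = (\<Sum>b\<in>basis. \<langle>y, b\<rangle> x \<otimes> b)\<close>\<close>

lift_definition tensor ::
  "'k :: chilbert_space \<Rightarrow> 'h :: chilbert_space \<Rightarrow> ('k, 'h) tensor_product" is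
  "\<lambda>x y. Abs_l2 (\<lambda>b. if b \<in> basis then cinner y b *\<^sub>C x else 0)"
  by (subst Abs_l2_inverse) (simp_all add: sq_summable_tensor)

lemma l2_apply_tensor:
  "l2_apply (tensor_rep (tensor x y)) b = (if b \<in> basis then cinner y b *\<^sub>C x else 0)"
  by (simp add: tensor.rep_eq Abs_l2_inverse sq_summable_tensor)

lemma cinner_tensor: "cinner (tensor x y) (tensor x' y') = cinner x x' * cinner y y'"
proof -
  have "((\<lambda>b. cinner (l2_apply (tensor_rep (tensor x y)) b) (l2_apply (tensor_rep (tensor x' y')) b))
      has_sum cinner x x' * cinner y y') UNIV
    \<longleftrightarrow> ((\<lambda>b. cinner x x' * (cinner y b * cinner b y')) has_sum cinner x x' * cinner y y') basis"
    by (rule has_sum_cong_neutral)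
      (auto simp: l2_apply_tensor cinner_scaleC_left cinner_scaleC_right
        simp flip: cinner_commute[of _ y'])
  moreover have "\<dots>"
    by (intro has_sum_cmult_right Parseval orthonormal_basis_basis)
  ultimately show ?thesis
    unfolding cinner_tensor_product.rep_eq cinner_l2_def by (simp add: infsumI)
qed

lemma tensor_total:
  assumes "\<And>x y. cinner t (tensor x y) = 0"
  shows "t = 0"
proof -
  have "l2_apply (tensor_rep t) d = 0" for d
  proof (cases "d \<in> basis")
    case True
    define v where "v = l2_apply (tensor_rep t) d"
    have "((\<lambda>b. cinner (l2_apply (tensor_rep t) b) (l2_apply (tensor_rep (tensor v d)) b))
        has_sum cinner v v) UNIV
      \<longleftrightarrow> ((\<lambda>b. cinner v v) has_sum cinner v v) {d}"
      using True orthonormal_basis_basis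
      by (intro has_sum_cong_neutral)
        (auto simp: l2_apply_tensor orthonormal_basis_def orthonormal_def v_def)
    moreover have "\<dots>" by (rule has_sum_finiteI) auto
    ultimately have "cinner t (tensor v d) = cinner v v"
      unfolding cinner_tensor_product.rep_eq cinner_l2_def by (simp add: infsumI)
    then have "v = 0" using assms[of v d] by (simp add: cinner_self)
    then show ?thesis by (simp add: v_def)
  next
    case False
    then show ?thesis using tensor_rep[of t] by simp
  qed
  then have "tensor_rep t = 0" by (intro l2_eqI) simp
  then show ?thesis by (metis tensor_rep_inject zero_tensor_product.rep_eq)
qed

section \<open>Operators\<close>

text \<open>\<open>B(H)\<close>: the elements of the type \<open>'a \<Rightarrow>\<^sub>L 'b\<close> are bounded but only real-linear.\<close>

definition bounded_ops :: "('a :: chilbert_space \<Rightarrow>\<^sub>L 'b :: chilbert_space) set" where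
  "bounded_ops = {T. \<forall>c x. blinfun_apply T (c *\<^sub>C x) = c *\<^sub>C blinfun_apply T x}"

definition adj ::
  "('a :: chilbert_space \<Rightarrow>\<^sub>L 'b :: chilbert_space) \<Rightarrow> ('b \<Rightarrow>\<^sub>L 'a)" where
  "adj T = (THE S. \<forall>x y. cinner (T x) y = cinner x (blinfun_apply S y))"

lemma Riesz_representation:
  fixes f :: "'a :: chilbert_space \<Rightarrow>\<^sub>L complex"
  assumes f: "f \<in> bounded_ops"
  shows "\<exists>v. \<forall>x. f x = cinner x v"
proof -
  have sc: "f (c *\<^sub>C x) = c * f x" for c x
    using f by (simp add: bounded_ops_def scaleC_complex_def)
  obtain B :: "'a set" where B: "orthonormal_basis B" using orthonormal_basis_exists by blast
  have on: "orthonormal B" using B by (simp add: orthonormal_basis_def)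
  define c where "c b = cnj (f b)" for b
  have fin: "(\<Sum>b\<in>F. (cmod (c b))\<^sup>2) \<le> (norm f)\<^sup>2" if F: "finite F" "F \<subseteq> B" for F
  proof -
    define s where "s = (\<Sum>b\<in>F. (cmod (c b))\<^sup>2)"
    define w where "w = (\<Sum>b\<in>F. c b *\<^sub>C b)"
    have s0: "s \<ge> 0" by (simp add: s_def sum_nonneg)
    have "f w = (\<Sum>b\<in>F. c b * f b)"
      by (simp add: w_def blinfun.sum_right sc)
    also have "\<dots> = complex_of_real s"
      by (simp add: s_def c_def complex_norm_square mult.commute del: of_real_power)
    finally have "s = cmod (f w)" using s0 by simp
    also have "\<dots> \<le> norm f * norm w" by (rule norm_blinfun)
    finally have "s\<^sup>2 \<le> (norm f * norm w)\<^sup>2" using s0 by (rule power_mono)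
    also have "\<dots> = (norm f)\<^sup>2 * s"
      by (simp add: power_mult_distrib w_def s_def norm_sum_orthonormal[OF on F])
    finally have "s * s \<le> (norm f)\<^sup>2 * s" by (simp add: power2_eq_square)
    then show ?thesis
      using s0 unfolding s_def[symmetric]
      by (cases "s = 0") (auto simp: mult_le_cancel_right)
  qed
  have "(\<lambda>b. (cmod (c b))\<^sup>2) summable_on B"
    by (rule nonneg_bdd_above_summable_on) (use fin in \<open>auto intro!: bdd_aboveI2\<close>)
  from orthonormal_summable[OF on this] obtain v where v: "((\<lambda>b. c b *\<^sub>C b) has_sum v) B"
    unfolding summable_on_def ..
  have "f x = cinner x v" for x
  proof -
    have "((\<lambda>b. f (cinner x b *\<^sub>C b)) has_sum f x) B"
      by (rule has_sum_bounded_linear[OF blinfun.bounded_linear_right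
            orthonormal_basis_expansion[OF B]])
    moreover have "((\<lambda>b. cinner x (c b *\<^sub>C b)) has_sum cinner x v) B"
      by (rule has_sum_bounded_linear[OF bounded_linear_cinner_right v])
    ultimately show ?thesis
      by (simp add: sc cinner_scaleC_right c_def mult.commute has_sum_unique)
  qed
  then show ?thesis by blast
qed

lemma adj_ex1:
  fixes T :: "'a :: chilbert_space \<Rightarrow>\<^sub>L 'b :: chilbert_space"
  assumes T: "T \<in> bounded_ops"
  shows "\<exists>!S. \<forall>x y. cinner (T x) y = cinner x (blinfun_apply S y)"
proof (rule ex_ex1I)
  have "\<exists>v. \<forall>x. cinner (T x) y = cinner x v" for y
  proof -
    have bl: "bounded_linear (\<lambda>x. cinner (T x) y)"
      by (rule bounded_linear_compose[OF bounded_linear_cinner_left blinfun.bounded_linear_right])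
    have "Blinfun (\<lambda>x. cinner (T x) y) \<in> bounded_ops"
      using T by (simp add: bounded_ops_def bounded_linear_Blinfun_apply[OF bl] cinner_scaleC_left
          scaleC_complex_def)
    from Riesz_representation[OF this] show ?thesis
      by (simp add: bounded_linear_Blinfun_apply[OF bl])
  qed
  then obtain g where g: "\<And>x y. cinner (T x) y = cinner x (g y)" by metis
  have add: "g (y + z) = g y + g z" for y z
  proof (rule cinner_ext)
    show "cinner (g (y + z)) x = cinner (g y + g z) x" for x
      by (subst (1 2) cinner_commute) (simp add: cinner_add_right flip: g)
  qed
  have scale: "g (c *\<^sub>C y) = c *\<^sub>C g y" for c y
  proof (rule cinner_ext)
    show "cinner (g (c *\<^sub>C y)) x = cinner (c *\<^sub>C g y) x" for x
      by (subst (1 2) cinner_commute) (simp add: cinner_scaleC_right flip: g)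
  qed
  have bound: "norm (g y) \<le> norm y * norm T" for y
  proof (cases "g y = 0")
    case False
    have "(norm (g y))\<^sup>2 = cmod (cinner (T (g y)) y)"
      by (simp add: g cinner_self norm_power)
    also have "\<dots> \<le> norm (T (g y)) * norm y" by (rule cinner_Cauchy_Schwarz)
    also have "\<dots> \<le> (norm T * norm (g y)) * norm y"
      by (intro mult_right_mono norm_blinfun) simp
    finally have "norm (g y) * norm (g y) \<le> norm (g y) * (norm y * norm T)"
      by (simp add: power2_eq_square algebra_simps)
    then show ?thesis using False by simp
  qed simp
  have "bounded_linear g"
    by (rule bounded_linear_intro[OF add _ bound]) (simp add: scaleR_eq_scaleC scale)
  then show "\<exists>S. \<forall>x y. cinner (T x) y = cinner x (blinfun_apply S y)"
    by (intro exI[of _ "Blinfun g"]) (simp add: bounded_linear_Blinfun_apply g)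
next
  fix S S' :: "'b \<Rightarrow>\<^sub>L 'a"
  assume S: "\<forall>x y. cinner (T x) y = cinner x (S y)" and S': "\<forall>x y. cinner (T x) y = cinner x (S' y)"
  have "S y = S' y" for y
  proof (rule cinner_ext)
    show "cinner (S y) x = cinner (S' y) x" for x
      by (subst (1 2) cinner_commute) (simp flip: S S')
  qed
  then show "S = S'" by (rule blinfun_eqI)
qed

lemma cinner_adj: "T \<in> bounded_ops \<Longrightarrow> cinner (T x) y = cinner x (adj T y)"
  using theI'[OF adj_ex1] unfolding adj_def by blast

definition positive_invertible :: "('a :: chilbert_space \<Rightarrow>\<^sub>L 'a) \<Rightarrow> bool" where
  "positive_invertible T \<longleftrightarrow> (\<forall>x. cinner (T x) x \<in> \<real>\<^sub>\<ge>\<^sub>0) \<and>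
     (\<exists>S\<in>bounded_ops. T o\<^sub>L S = id_blinfun \<and> S o\<^sub>L T = id_blinfun)"

definition tensor_op ::
  "('k :: chilbert_space \<Rightarrow>\<^sub>L 'k) \<Rightarrow> ('h :: chilbert_space \<Rightarrow>\<^sub>L 'h) \<Rightarrow>
   ('k, 'h) tensor_product \<Rightarrow>\<^sub>L ('k, 'h) tensor_product" where
  "tensor_op A X =
    (THE T. T \<in> bounded_ops \<and> (\<forall>x y. blinfun_apply T (tensor x y) = tensor (A x) (X y)))"

section \<open>The regular polyball\<close>

text \<open>
  The list \<open>n\<close> is the multi-index \<open>(n\<^sub>1, \<dots>, n\<^sub>k)\<close>; all indices start at \<open>0\<close>. A tuple
  \<open>(X\<^sub>1, \<dots>, X\<^sub>k)\<close> is a function \<open>X\<close> such that \<open>X i j\<close> is the \<open>j\<close>-th entry of the \<open>i\<close>-th component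
  and \<open>X i j = 0\<close> outside the range of the indices.
\<close>

type_synonym 'h op_tuple = "nat \<Rightarrow> nat \<Rightarrow> ('h \<Rightarrow>\<^sub>L 'h)"

definition commuting_tuples :: "nat list \<Rightarrow> 'h :: chilbert_space op_tuple set" where
  "commuting_tuples n =
    {X. (\<forall>i j. if i < length n \<and> j < n ! i then X i j \<in> bounded_ops else X i j = 0) \<and>
        (\<forall>s<length n. \<forall>t<length n. s \<noteq> t \<longrightarrow>
          (\<forall>i<n ! s. \<forall>j<n ! t. X s i o\<^sub>L X t j = X t j o\<^sub>L X s i))}"

definition cp_map ::
  "nat list \<Rightarrow> 'h :: chilbert_space op_tuple \<Rightarrow> nat \<Rightarrow> ('h \<Rightarrow>\<^sub>L 'h) \<Rightarrow> ('h \<Rightarrow>\<^sub>L 'h)" where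
  "cp_map n X i Y = (\<Sum>j<n ! i. X i j o\<^sub>L Y o\<^sub>L adj (X i j))"

definition defect ::
  "nat list \<Rightarrow> 'h :: chilbert_space op_tuple \<Rightarrow> ('h \<Rightarrow>\<^sub>L 'h) \<Rightarrow> ('h \<Rightarrow>\<^sub>L 'h)" where
  "defect n X = foldr (\<lambda>i Y. Y - cp_map n X i Y) [0..<length n]"

definition polyball :: "nat list \<Rightarrow> 'h :: chilbert_space op_tuple set" where
  "polyball n =
    {X \<in> commuting_tuples n.
      (\<forall>i<length n. norm (\<Sum>j<n ! i. X i j o\<^sub>L adj (X i j)) < 1) \<and>
      positive_invertible (defect n X id_blinfun)}"

definition scale_tuple :: "real \<Rightarrow> 'h :: chilbert_space op_tuple \<Rightarrow> 'h op_tuple" where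
  "scale_tuple r X = (\<lambda>i j. r *\<^sub>R X i j)"

definition scaled_polyball :: "ennreal \<Rightarrow> nat list \<Rightarrow> 'h :: chilbert_space op_tuple set" where
  "scaled_polyball \<gamma> n =
    (if \<gamma> = \<infinity> then \<Union>\<rho>\<in>{0<..}. scale_tuple \<rho> ` polyball n
     else scale_tuple (enn2real \<gamma>) ` polyball n)"

text \<open>
  \<open>r B\<^sub>n(H)\<^sup>-\<close>. The topology on functions is that of pointwise convergence; as only finitely many
  entries of the tuples in \<open>polyball n\<close> are nonzero, \<open>closure\<close> is the operator norm closure.
\<close>

definition closed_polyball :: "real \<Rightarrow> nat list \<Rightarrow> 'h :: chilbert_space op_tuple set" where
  "closed_polyball r n = scale_tuple r ` closure (polyball n)"

section \<open>Power series\<close>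

definition multi_degrees :: "nat list \<Rightarrow> nat list set" where
  "multi_degrees n = {p. length p = length n}"

text \<open>The word \<open>g\<^sub>j\<^sub>1 \<dots> g\<^sub>j\<^sub>p\<close> is the list \<open>[j\<^sub>1, \<dots>, j\<^sub>p]\<close>.\<close>

definition multi_words :: "nat list \<Rightarrow> nat list list set" where
  "multi_words n = {\<alpha>. length \<alpha> = length n \<and> (\<forall>i<length n. set (\<alpha> ! i) \<subseteq> {..<n ! i})}"

definition multi_words_of_degree :: "nat list \<Rightarrow> nat list \<Rightarrow> nat list list set" where
  "multi_words_of_degree n p = {\<alpha> \<in> multi_words n. map length \<alpha> = p}"

definition word_op :: "'h :: chilbert_space op_tuple \<Rightarrow> nat \<Rightarrow> nat list \<Rightarrow> ('h \<Rightarrow>\<^sub>L 'h)" where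
  "word_op X i w = foldr (\<lambda>j T. X i j o\<^sub>L T) w id_blinfun"

definition multi_word_op :: "'h :: chilbert_space op_tuple \<Rightarrow> nat list list \<Rightarrow> ('h \<Rightarrow>\<^sub>L 'h)" where
  "multi_word_op X \<alpha> = foldr (\<lambda>i T. word_op X i (\<alpha> ! i) o\<^sub>L T) [0..<length \<alpha>] id_blinfun"

definition homogeneous_part ::
  "nat list \<Rightarrow> (nat list list \<Rightarrow> ('k :: chilbert_space \<Rightarrow>\<^sub>L 'k)) \<Rightarrow> 'h :: chilbert_space op_tuple \<Rightarrow>
   nat list \<Rightarrow> ('k, 'h) tensor_product \<Rightarrow>\<^sub>L ('k, 'h) tensor_product" where
  "homogeneous_part n A X p =
    (\<Sum>\<alpha>\<in>multi_words_of_degree n p. tensor_op (A \<alpha>) (multi_word_op X \<alpha>))"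

text \<open>
  The limsup over \<open>\<int>\<^sub>+\<^sup>k\<close> is taken along the cofinite filter, that is for \<open>p\<^sub>1 + \<dots> + p\<^sub>k \<rightarrow> \<infinity>\<close>, and
  not only for \<open>p\<^sub>i \<rightarrow> \<infinity>\<close> in each coordinate. In particular the value at \<open>p = 0\<close>, where the
  exponent \<open>1 / (2 (p\<^sub>1 + \<dots> + p\<^sub>k))\<close> makes no sense, is irrelevant.
\<close>

definition multi_limsup :: "nat list \<Rightarrow> (nat list \<Rightarrow> ennreal) \<Rightarrow> ennreal" where
  "multi_limsup n f = Limsup (inf cofinite (principal (multi_degrees n))) f"

end

theory Submission
  imports Defs "HOL-Library.Nat_Bijection"
begin

text \<open>
  Both parts compare the homogeneous part \<open>\<Sum>A\<^sub>\<alpha> \<otimes> X\<^sub>\<alpha>\<close> of multi-degree \<open>p\<close> with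
  \<open>c\<^sub>p = \<parallel>\<Sum>A\<^sub>\<alpha>\<^sup>* A\<^sub>\<alpha>\<parallel>\<^sup>1\<^sup>/\<^sup>2\<close>, the number whose growth defines \<open>\<gamma>\<close>.

  Upper bound. The sum \<open>\<Sum>A\<^sub>\<alpha> \<otimes> X\<^sub>\<alpha> = \<Sum>(I \<otimes> X\<^sub>\<alpha>)(A\<^sub>\<alpha> \<otimes> I)\<close> is a row operator times a column operator.
  The column has norm at most \<open>c\<^sub>p\<close>, and amplifying the row by \<open>I\<close> does not increase its norm
  (\<open>norm_sum_tensor_op_le\<close>). Norms of rows are submultiplicative, so if the rows
  \<open>(X\<^sub>i\<^sub>,\<^sub>1, \<dots>, X\<^sub>i\<^sub>,\<^sub>m)\<close> have norm at most \<open>r\<close>, then the row of all \<open>X\<^sub>\<alpha>\<close> of multi-degree \<open>p\<close> has norm at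
  most \<open>r\<^sup>|\<^sup>p\<^sup>|\<close> (\<open>row_bound_multi_words\<close>). On the closed polyball of radius \<open>r\<close> the homogeneous parts are
  therefore bounded by \<open>r\<^sup>|\<^sup>p\<^sup>| c\<^sub>p\<close>. For \<open>r < \<gamma>\<close> this is, up to finitely many \<open>p\<close>, below a geometric series
  over the multi-degrees (\<open>summable_on_radius\<close>), and the Weierstrass test gives part (i) on closed
  polyballs. An individual point of the open polyball has rows of norm strictly below \<open>1\<close>, which
  reduces convergence on \<open>\<gamma>B\<^sub>n\<close> to some radius below \<open>\<gamma>\<close>.

  Lower bound. Let \<open>S\<^sub>i\<^sub>,\<^sub>j\<close> be the left creation operators on the Hilbert space with orthonormal basis
  the multi-words: \<open>S\<^sub>i\<^sub>,\<^sub>j\<close> puts the letter \<open>j\<close> in front of the \<open>i\<close>-th word. The defect of \<open>rS\<close> at \<open>I\<close> is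
  diagonal with entries that are products of factors \<open>1\<close> and \<open>1 - r\<^sup>2\<close>; so \<open>rS\<close> lies in the polyball
  for \<open>r < 1\<close> (\<open>model_in_polyball\<close>) and \<open>S\<close> in its closure. The operators \<open>S\<^sub>\<alpha>\<close> map the vacuum
  vector to orthonormal vectors, hence
  \<open>\<parallel>(\<Sum>A\<^sub>\<alpha> \<otimes> s\<^sup>|\<^sup>p\<^sup>|S\<^sub>\<alpha>)(x \<otimes> vacuum)\<parallel>\<^sup>2 = s\<^sup>2\<^sup>|\<^sup>p\<^sup>| \<Sum>\<parallel>A\<^sub>\<alpha> x\<parallel>\<^sup>2\<close>, and the homogeneous parts at \<open>sS\<close> have norm at
  least \<open>s\<^sup>|\<^sup>p\<^sup>| c\<^sub>p\<close> (\<open>norm_homogeneous_part_model_ge\<close>). If the series converged at \<open>sS\<close>, these numbers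
  would eventually be below \<open>1\<close>, which forces \<open>1/\<gamma> \<le> 1/s\<close>. That contradicts \<open>s > \<gamma>\<close>.
\<close>

section \<open>Complex-linear operators and adjoints\<close>

lemma bounded_opsI: "(\<And>c x. blinfun_apply T (c *\<^sub>C x) = c *\<^sub>C T x) \<Longrightarrow> T \<in> bounded_ops"
  by (simp add: bounded_ops_def)

lemma bounded_opsD: "T \<in> bounded_ops \<Longrightarrow> T (c *\<^sub>C x) = c *\<^sub>C T x"
  by (simp add: bounded_ops_def)

lemma scaleC_scaleR_commute: "c *\<^sub>C (r *\<^sub>R x) = r *\<^sub>R (c *\<^sub>C (x :: 'a :: chilbert_space))"
  by (simp add: scaleR_eq_scaleC scaleC_scaleC mult.commute)

lemma bounded_ops_zero: "0 \<in> bounded_ops"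
  by (rule bounded_opsI) simp

lemma bounded_ops_id: "id_blinfun \<in> bounded_ops"
  by (rule bounded_opsI) simp

lemma bounded_ops_compose:
  "S \<in> bounded_ops \<Longrightarrow> T \<in> bounded_ops \<Longrightarrow> S o\<^sub>L T \<in> bounded_ops"
  by (rule bounded_opsI) (simp add: bounded_opsD)

lemma bounded_ops_scaleR: "T \<in> bounded_ops \<Longrightarrow> r *\<^sub>R T \<in> bounded_ops"
  by (rule bounded_opsI) (simp add: bounded_opsD scaleR_blinfun.rep_eq scaleC_scaleR_commute)

lemma adj_eqI:
  assumes "\<And>x y. cinner (blinfun_apply T x) y = cinner x (blinfun_apply S y)"
  shows "adj T = S"
proof -
  have "T \<in> bounded_ops"
  proof (rule bounded_opsI, rule cinner_ext)
    show "cinner (T (c *\<^sub>C x)) z = cinner (c *\<^sub>C T x) z" for c x z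
      by (simp add: assms cinner_scaleC_left)
  qed
  then show ?thesis
    unfolding adj_def using assms by (intro the1_equality adj_ex1) auto
qed

lemma adj_in_bounded_ops:
  assumes "T \<in> bounded_ops"
  shows "adj T \<in> bounded_ops"
proof (rule bounded_opsI, rule cinner_ext)
  show "cinner (adj T (c *\<^sub>C y)) z = cinner (c *\<^sub>C adj T y) z" for c y z
    by (subst (1 2) cinner_commute) (simp add: cinner_scaleC_right flip: cinner_adj[OF assms])
qed

lemma cinner_adj_left: "T \<in> bounded_ops \<Longrightarrow> cinner (adj T y) x = cinner y (T x)"
  using cinner_adj[of T x y] cinner_commute[of "adj T y" x] cinner_commute[of y "T x"] by simp

lemma norm_sq_eq_cinner: "complex_of_real ((norm x)\<^sup>2) = cinner x x"
  by (rule cinner_self[symmetric])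

lemma of_real_eq_imp_eq_cmod: "complex_of_real r = z \<Longrightarrow> 0 \<le> r \<Longrightarrow> r = cmod z"
  by auto

section \<open>Row contractions and column contractions\<close>

text \<open>The inequality says that the row operator \<open>(y\<^sub>i) \<mapsto> \<Sum>T\<^sub>i y\<^sub>i\<close> on the direct sum has norm at most
  \<open>\<bar>c\<bar>\<close>. Unlike the equivalent bound \<open>\<parallel>\<Sum>T\<^sub>i T\<^sub>i\<^sup>*\<parallel> \<le> c\<^sup>2\<close> it does not mention adjoints; so it visibly passes to
  limits of tuples and to products.\<close>

definition row_bound ::
  "'i set \<Rightarrow> ('i \<Rightarrow> 'a :: chilbert_space \<Rightarrow>\<^sub>L 'b :: chilbert_space) \<Rightarrow> real \<Rightarrow> bool" where
  "row_bound F T c \<longleftrightarrow>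
    (\<forall>y. (norm (\<Sum>i\<in>F. T i (y i)))\<^sup>2 \<le> c\<^sup>2 * (\<Sum>i\<in>F. (norm (y i))\<^sup>2))"

lemma row_boundD:
  "row_bound F T c \<Longrightarrow> (norm (\<Sum>i\<in>F. T i (y i)))\<^sup>2 \<le> c\<^sup>2 * (\<Sum>i\<in>F. (norm (y i))\<^sup>2)"
  by (simp add: row_bound_def)

lemma row_bound_reindex:
  assumes "bij_betw h G F" "row_bound G (\<lambda>j. T (h j)) c"
  shows "row_bound F T c"
  unfolding row_bound_def
proof
  fix y :: "_ \<Rightarrow> 'c"
  show "(norm (\<Sum>i\<in>F. T i (y i)))\<^sup>2 \<le> c\<^sup>2 * (\<Sum>i\<in>F. (norm (y i))\<^sup>2)"
    using row_boundD[OF assms(2), of "\<lambda>j. y (h j)"]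
      sum.reindex_bij_betw[OF assms(1), of "\<lambda>i. T i (y i)"]
      sum.reindex_bij_betw[OF assms(1), of "\<lambda>i. (norm (y i))\<^sup>2"] by simp
qed

lemma row_bound_scaleR: "row_bound F T c \<Longrightarrow> row_bound F (\<lambda>i. r *\<^sub>R T i) (r * c)"
  unfolding row_bound_def
  by (simp add: scaleR_blinfun.rep_eq power_mult_distrib mult.assoc mult_left_mono
      flip: scaleR_sum_right)

text \<open>The product row is the row \<open>S\<close> applied to the vectors that the row \<open>T\<close> produces for each fixed
  first index.\<close>

lemma row_bound_product:
  assumes "row_bound F S c" "row_bound G T d"
  shows "row_bound (F \<times> G) (\<lambda>(i, j). S i o\<^sub>L T j) (c * d)"
  unfolding row_bound_def
proof
  fix y :: "_ \<Rightarrow> 'e"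
  have "(norm (\<Sum>p\<in>F \<times> G. (case p of (i, j) \<Rightarrow> S i o\<^sub>L T j) (y p)))\<^sup>2
      = (norm (\<Sum>i\<in>F. S i (\<Sum>j\<in>G. T j (y (i, j)))))\<^sup>2"
    by (simp add: sum.cartesian_product' blinfun.sum_right case_prod_unfold)
  also have "\<dots> \<le> c\<^sup>2 * (\<Sum>i\<in>F. (norm (\<Sum>j\<in>G. T j (y (i, j))))\<^sup>2)"
    by (rule row_boundD[OF assms(1)])
  also have "\<dots> \<le> c\<^sup>2 * (\<Sum>i\<in>F. d\<^sup>2 * (\<Sum>j\<in>G. (norm (y (i, j)))\<^sup>2))"
    by (intro mult_left_mono sum_mono row_boundD[OF assms(2)]) auto
  also have "\<dots> = (c * d)\<^sup>2 * (\<Sum>p\<in>F \<times> G. (norm (y p))\<^sup>2)"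
    by (simp add: sum.cartesian_product' power_mult_distrib sum_distrib_left mult.assoc)
  finally show "(norm (\<Sum>p\<in>F \<times> G. (case p of (i, j) \<Rightarrow> S i o\<^sub>L T j) (y p)))\<^sup>2
      \<le> (c * d)\<^sup>2 * (\<Sum>p\<in>F \<times> G. (norm (y p))\<^sup>2)" .
qed

lemma cmod_sum_cinner_le:
  fixes x y :: "'i \<Rightarrow> 'a :: chilbert_space"
  shows "cmod (\<Sum>i\<in>F. cinner (x i) (y i))
    \<le> sqrt (\<Sum>i\<in>F. (norm (x i))\<^sup>2) * sqrt (\<Sum>i\<in>F. (norm (y i))\<^sup>2)"
proof -
  have "cmod (\<Sum>i\<in>F. cinner (x i) (y i)) \<le> (\<Sum>i\<in>F. \<bar>norm (x i)\<bar> * \<bar>norm (y i)\<bar>)"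
    by (rule order.trans[OF norm_sum]) (auto intro!: sum_mono cinner_Cauchy_Schwarz)
  also have "\<dots> \<le> sqrt (\<Sum>i\<in>F. (norm (x i))\<^sup>2) * sqrt (\<Sum>i\<in>F. (norm (y i))\<^sup>2)"
    using L2_set_mult_ineq unfolding L2_set_def .
  finally show ?thesis .
qed

text \<open>The square of the norm of \<open>z = \<Sum>T\<^sub>i y\<^sub>i\<close> is \<open>\<Sum>\<langle>y\<^sub>i, T\<^sub>i\<^sup>* z\<rangle>\<close>, and
  \<open>\<Sum>\<parallel>T\<^sub>i\<^sup>* z\<parallel>\<^sup>2 = \<langle>(\<Sum>T\<^sub>i T\<^sub>i\<^sup>*) z, z\<rangle>\<close>; so Cauchy-Schwarz bounds \<open>\<parallel>z\<parallel>\<close>.\<close>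

lemma row_bound_norm_sum_adj:
  assumes T: "\<And>i. i \<in> F \<Longrightarrow> T i \<in> bounded_ops"
  shows "row_bound F T (sqrt (norm (\<Sum>i\<in>F. T i o\<^sub>L adj (T i))))"
  unfolding row_bound_def
proof
  fix y :: "_ \<Rightarrow> 'b"
  define P where "P = (\<Sum>i\<in>F. T i o\<^sub>L adj (T i))"
  define z where "z = (\<Sum>i\<in>F. T i (y i))"
  have adj_sum: "(\<Sum>i\<in>F. (norm (adj (T i) z))\<^sup>2) \<le> norm P * (norm z)\<^sup>2"
  proof -
    have "complex_of_real (\<Sum>i\<in>F. (norm (adj (T i) z))\<^sup>2) = cinner (P z) z"
      by (simp add: norm_sq_eq_cinner P_def blinfun.sum_left cinner_sum_left cinner_adj[OF T]
          del: of_real_power)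
    then have "(\<Sum>i\<in>F. (norm (adj (T i) z))\<^sup>2) = cmod (cinner (P z) z)"
      by (rule of_real_eq_imp_eq_cmod) (simp add: sum_nonneg)
    also have "\<dots> \<le> norm (P z) * norm z" by (rule cinner_Cauchy_Schwarz)
    also have "\<dots> \<le> norm P * norm z * norm z"
      by (intro mult_right_mono norm_blinfun) simp
    finally show ?thesis by (simp add: power2_eq_square mult.assoc)
  qed
  have "(norm z)\<^sup>2 = cmod (\<Sum>i\<in>F. cinner (y i) (adj (T i) z))"
  proof -
    have "complex_of_real ((norm z)\<^sup>2) = (\<Sum>i\<in>F. cinner (T i (y i)) z)"
      unfolding norm_sq_eq_cinner by (subst (1) z_def) (simp add: cinner_sum_left)
    also have "\<dots> = (\<Sum>i\<in>F. cinner (y i) (adj (T i) z))"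
      by (simp add: cinner_adj[OF T])
    finally show ?thesis by (rule of_real_eq_imp_eq_cmod) simp
  qed
  also have "\<dots> \<le> sqrt (\<Sum>i\<in>F. (norm (y i))\<^sup>2) * sqrt (\<Sum>i\<in>F. (norm (adj (T i) z))\<^sup>2)"
    by (rule cmod_sum_cinner_le)
  also have "\<dots> \<le> sqrt (\<Sum>i\<in>F. (norm (y i))\<^sup>2) * sqrt (norm P * (norm z)\<^sup>2)"
    by (intro mult_left_mono real_sqrt_le_mono adj_sum) (simp add: sum_nonneg)
  also have "\<dots> = (sqrt (\<Sum>i\<in>F. (norm (y i))\<^sup>2) * sqrt (norm P)) * norm z"
    by (simp add: real_sqrt_mult)
  finally have "norm z * norm z \<le> (sqrt (\<Sum>i\<in>F. (norm (y i))\<^sup>2) * sqrt (norm P)) * norm z"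
    by (simp add: power2_eq_square)
  then have "norm z \<le> sqrt (\<Sum>i\<in>F. (norm (y i))\<^sup>2) * sqrt (norm P)"
    by (cases "norm z = 0") (auto simp: mult_le_cancel_right sum_nonneg)
  then have "(norm z)\<^sup>2 \<le> (sqrt (\<Sum>i\<in>F. (norm (y i))\<^sup>2) * sqrt (norm P))\<^sup>2"
    by (intro power_mono) auto
  then show "(norm z)\<^sup>2 \<le> (sqrt (norm P))\<^sup>2 * (\<Sum>i\<in>F. (norm (y i))\<^sup>2)"
    by (simp add: power_mult_distrib sum_nonneg mult.commute)
qed

lemma sum_adj_column:
  assumes "\<And>i. i \<in> F \<Longrightarrow> A i \<in> bounded_ops"
  shows "cinner ((\<Sum>i\<in>F. adj (A i) o\<^sub>L A i) x) y = (\<Sum>i\<in>F. cinner (A i x) (A i y))"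
  using assms by (simp add: blinfun.sum_left cinner_sum_left cinner_adj_left)

lemma column_bound:
  assumes "\<And>i. i \<in> F \<Longrightarrow> A i \<in> bounded_ops"
  shows "(\<Sum>i\<in>F. (norm (A i x))\<^sup>2) \<le> norm (\<Sum>i\<in>F. adj (A i) o\<^sub>L A i) * (norm x)\<^sup>2"
proof -
  define P where "P = (\<Sum>i\<in>F. adj (A i) o\<^sub>L A i)"
  have "complex_of_real (\<Sum>i\<in>F. (norm (A i x))\<^sup>2) = cinner (P x) x"
    by (simp add: norm_sq_eq_cinner P_def sum_adj_column[OF assms] del: of_real_power)
  then have "(\<Sum>i\<in>F. (norm (A i x))\<^sup>2) = cmod (cinner (P x) x)"
    by (rule of_real_eq_imp_eq_cmod) (simp add: sum_nonneg)
  also have "\<dots> \<le> norm (P x) * norm x" by (rule cinner_Cauchy_Schwarz)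
  also have "\<dots> \<le> norm P * norm x * norm x"
    by (intro mult_right_mono norm_blinfun) simp
  finally show ?thesis by (simp add: P_def power2_eq_square mult.assoc)
qed

text \<open>The converse of the previous bound: \<open>P = \<Sum>A\<^sub>i\<^sup>* A\<^sub>i\<close> satisfies
  \<open>\<parallel>P x\<parallel>\<^sup>2 = \<Sum>\<langle>A\<^sub>i x, A\<^sub>i P x\<rangle> \<le> C \<parallel>x\<parallel> \<parallel>P x\<parallel>\<close> by Cauchy-Schwarz.\<close>

lemma norm_sum_adj_column_le:
  assumes A: "\<And>i. i \<in> F \<Longrightarrow> A i \<in> bounded_ops" and "0 \<le> C"
    and bound: "\<And>x. (\<Sum>i\<in>F. (norm (A i x))\<^sup>2) \<le> C * (norm x)\<^sup>2"
  shows "norm (\<Sum>i\<in>F. adj (A i) o\<^sub>L A i) \<le> C"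
proof (rule norm_blinfun_bound[OF \<open>0 \<le> C\<close>])
  fix x
  define P where "P = (\<Sum>i\<in>F. adj (A i) o\<^sub>L A i)"
  have "(norm (P x))\<^sup>2 = cmod (\<Sum>i\<in>F. cinner (A i x) (A i (P x)))"
  proof -
    have "complex_of_real ((norm (P x))\<^sup>2) = (\<Sum>i\<in>F. cinner (A i x) (A i (P x)))"
      unfolding norm_sq_eq_cinner by (subst (1) P_def) (rule sum_adj_column[OF A])
    then show ?thesis by (rule of_real_eq_imp_eq_cmod) simp
  qed
  also have "\<dots> \<le> sqrt (\<Sum>i\<in>F. (norm (A i x))\<^sup>2) * sqrt (\<Sum>i\<in>F. (norm (A i (P x)))\<^sup>2)"
    by (rule cmod_sum_cinner_le)
  also have "\<dots> \<le> sqrt (C * (norm x)\<^sup>2) * sqrt (C * (norm (P x))\<^sup>2)"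
    using \<open>0 \<le> C\<close> by (intro mult_mono real_sqrt_le_mono bound) (auto intro!: sum_nonneg)
  also have "\<dots> = C * norm x * norm (P x)"
    using \<open>0 \<le> C\<close> by (simp add: real_sqrt_mult)
  finally have "norm (P x) * norm (P x) \<le> (C * norm x) * norm (P x)"
    by (simp add: power2_eq_square)
  then show "norm (P x) \<le> C * norm x"
    using \<open>0 \<le> C\<close> by (cases "norm (P x) = 0") (auto simp: mult_le_cancel_right)
qed

section \<open>Operators on tensor products\<close>

text \<open>A tensor \<open>t\<close> has a coordinate in the first factor for every basis vector of the second.
  Operators \<open>A \<otimes> I\<close> act coordinatewise. Operators \<open>I \<otimes> X\<close> do not, and are obtained from them by
  exchanging the two factors.\<close>

abbreviation coord ::
  "('k :: chilbert_space, 'h :: chilbert_space) tensor_product \<Rightarrow> 'h \<Rightarrow> 'k" where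
  "coord t b \<equiv> l2_apply (tensor_rep t) b"

definition of_coords ::
  "('h :: chilbert_space \<Rightarrow> 'k :: chilbert_space) \<Rightarrow> ('k, 'h) tensor_product" where
  "of_coords f = Abs_tensor (Abs_l2 f)"

lemma coord_of_coords:
  assumes "(\<lambda>b. (norm (f b))\<^sup>2) summable_on UNIV" "\<And>b. b \<notin> basis \<Longrightarrow> f b = 0"
  shows "coord (of_coords f) b = f b"
  using assms by (simp add: of_coords_def Abs_l2_inverse Abs_tensor_inverse)

lemma coord_outside_basis: "b \<notin> basis \<Longrightarrow> coord t b = 0"
  using tensor_rep[of t] by simp

lemma tensor_eqI: "(\<And>b. coord s b = coord t b) \<Longrightarrow> s = t"
  by (metis l2_eqI tensor_rep_inject)

lemma coord_simps [simp]:
  "coord 0 b = 0" "coord (s + t) b = coord s b + coord t b"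
  "coord (r *\<^sub>R t) b = r *\<^sub>R coord t b" "coord (c *\<^sub>C t) b = c *\<^sub>C coord t b"
  by (simp_all add: zero_tensor_product.rep_eq plus_tensor_product.rep_eq
      scaleR_tensor_product.rep_eq scaleC_tensor_product.rep_eq)

lemma coord_sum: "coord (\<Sum>i\<in>F. t i) b = (\<Sum>i\<in>F. coord (t i) b)"
  by (induction F rule: infinite_finite_induct) auto

lemma l2_norm_has_sum: "((\<lambda>b. (norm (l2_apply f b))\<^sup>2) has_sum (norm f)\<^sup>2) UNIV"
  using has_sum_infsum[OF l2_summable[of f]]
  by (simp add: power2_norm_eq_inner[of f] inner_l2_self)

lemma coord_norm_has_sum: "((\<lambda>b. (norm (coord t b))\<^sup>2) has_sum (norm t)\<^sup>2) UNIV"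
  by (simp add: norm_tensor_product.rep_eq l2_norm_has_sum)

lemma has_sum_finite_sum:
  fixes f :: "'i \<Rightarrow> 'a \<Rightarrow> real"
  assumes "\<And>i. i \<in> F \<Longrightarrow> (f i has_sum s i) S"
  shows "((\<lambda>x. \<Sum>i\<in>F. f i x) has_sum (\<Sum>i\<in>F. s i)) S"
  using assms by (induction F rule: infinite_finite_induct) (auto intro: has_sum_add)

lemma coord_tensor: "coord (tensor x y) b = (if b \<in> basis then cinner y b *\<^sub>C x else 0)"
  by (rule l2_apply_tensor)

definition left_op :: "('k :: chilbert_space \<Rightarrow>\<^sub>L 'l :: chilbert_space) \<Rightarrow>
    ('k, 'h :: chilbert_space) tensor_product \<Rightarrow>\<^sub>L ('l, 'h) tensor_product" where
  "left_op A = Blinfun (\<lambda>t. of_coords (\<lambda>b. A (coord t b)))"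

lemma coord_left_op:
  fixes t :: "('k :: chilbert_space, 'h :: chilbert_space) tensor_product"
  shows "coord (left_op A t) b = A (coord t b)"
proof -
  define g :: "('k, 'h) tensor_product \<Rightarrow> _" where "g t = of_coords (\<lambda>b. A (coord t b))" for t
  have le: "(norm (A (coord t b)))\<^sup>2 \<le> (norm A)\<^sup>2 * (norm (coord t b))\<^sup>2" for t b
    by (metis norm_blinfun norm_ge_zero power_mono power_mult_distrib)
  have "(\<lambda>b. (norm (A (coord t b)))\<^sup>2) summable_on UNIV" for t
    by (rule summable_on_comparison_test[OF summable_on_cmult_right
          [OF has_sum_imp_summable[OF coord_norm_has_sum[of t]]] le]) auto
  then have "coord (of_coords (\<lambda>b. A (coord t b))) b = A (coord t b)" for t b
    by (rule coord_of_coords) (simp add: coord_outside_basis)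
  then have c: "coord (g t) b = A (coord t b)" for t b
    unfolding g_def .
  have "bounded_linear g"
  proof (rule bounded_linear_intro[where K = "norm A"])
    show "norm (g t) \<le> norm t * norm A" for t
    proof (rule power2_le_imp_le)
      have "(norm (g t))\<^sup>2 \<le> (norm A)\<^sup>2 * (norm t)\<^sup>2"
        by (rule has_sum_mono[OF coord_norm_has_sum has_sum_cmult_right[OF coord_norm_has_sum]])
          (simp only: c le)
      then show "(norm (g t))\<^sup>2 \<le> (norm t * norm A)\<^sup>2"
        by (simp only: power_mult_distrib mult.commute)
    qed simp
  qed (auto intro!: tensor_eqI simp: c blinfun.add_right blinfun.scaleR_right)
  moreover have "left_op A = Blinfun g" by (simp only: left_op_def g_def[abs_def])
  ultimately show ?thesis by (simp add: bounded_linear_Blinfun_apply c)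
qed

lemma left_op_bounded_ops: "A \<in> bounded_ops \<Longrightarrow> left_op A \<in> bounded_ops"
  by (auto intro!: bounded_opsI tensor_eqI simp: coord_left_op bounded_opsD)

lemma left_op_tensor: "A \<in> bounded_ops \<Longrightarrow> left_op A (tensor x y) = tensor (A x) y"
  by (rule tensor_eqI) (simp add: coord_left_op coord_tensor bounded_opsD)

lemma row_bound_left_op:
  assumes "row_bound F T c"
  shows "row_bound F (\<lambda>i. left_op (T i)) c"
  unfolding row_bound_def
proof
  fix y :: "_ \<Rightarrow> ('b, 'd) tensor_product"
  show "(norm (\<Sum>i\<in>F. left_op (T i) (y i)))\<^sup>2 \<le> c\<^sup>2 * (\<Sum>i\<in>F. (norm (y i))\<^sup>2)"
    by (rule has_sum_mono[OF coord_norm_has_sum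
          has_sum_cmult_right[OF has_sum_finite_sum[OF coord_norm_has_sum]]])
      (simp add: coord_sum coord_left_op row_boundD[OF assms])
qed

lemma column_bound_left_op:
  assumes "\<And>x. (\<Sum>i\<in>F. (norm (blinfun_apply (A i) x))\<^sup>2) \<le> C * (norm x)\<^sup>2"
  shows "(\<Sum>i\<in>F. (norm (left_op (A i) t))\<^sup>2) \<le> C * (norm t)\<^sup>2"
  by (rule has_sum_mono[OF has_sum_finite_sum[OF coord_norm_has_sum]
        has_sum_cmult_right[OF coord_norm_has_sum]])
    (simp add: coord_left_op assms)

lemma tensor_scaleC_right: "tensor x (c *\<^sub>C y) = c *\<^sub>C tensor x y"
  by (rule tensor_eqI) (simp add: coord_tensor scaleC_scaleC cinner_scaleC_left)

lemma tensor_add_right: "tensor x (y + z) = tensor x y + tensor x z"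
  by (rule tensor_eqI) (simp add: coord_tensor cinner_add_left scaleC_add_left)

lemma norm_tensor: "norm (tensor x y) = norm x * norm y"
proof -
  have "complex_of_real ((norm (tensor x y))\<^sup>2) = of_real ((norm x * norm y)\<^sup>2)"
    by (simp only: norm_sq_eq_cinner cinner_tensor) (simp add: cinner_self power_mult_distrib)
  then have "(norm (tensor x y))\<^sup>2 = (norm x * norm y)\<^sup>2" by (simp only: of_real_eq_iff)
  then show ?thesis by (simp add: power2_eq_iff_nonneg)
qed

definition tensor_with :: "'k :: chilbert_space \<Rightarrow>
    'h :: chilbert_space \<Rightarrow>\<^sub>L ('k, 'h) tensor_product" where
  "tensor_with x = Blinfun (tensor x)"

lemma tensor_with_apply:
  fixes y :: "'h :: chilbert_space"
  shows "tensor_with x y = tensor x y"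
proof -
  have "bounded_linear (tensor x :: 'h \<Rightarrow> _)"
    by (rule bounded_linear_intro[where K = "norm x"])
      (auto simp: tensor_add_right scaleR_eq_scaleC tensor_scaleC_right norm_tensor mult.commute)
  then show ?thesis by (simp add: tensor_with_def bounded_linear_Blinfun_apply)
qed

lemma tensor_with_bounded_ops: "tensor_with x \<in> bounded_ops"
  by (rule bounded_opsI) (simp add: tensor_with_apply tensor_scaleC_right)

lemma coord_eq_slice:
  assumes "b \<in> basis"
  shows "cinner (coord t b) x = cinner t (tensor x b)"
proof -
  have "((\<lambda>d. cinner (coord t d) (coord (tensor x b) d)) has_sum cinner (coord t b) x) UNIV
      \<longleftrightarrow> ((\<lambda>d. cinner (coord t b) x) has_sum cinner (coord t b) x) {b}"
    using assms orthonormal_basis_basis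
    by (intro has_sum_cong_neutral)
      (auto simp: coord_tensor orthonormal_basis_def orthonormal_def)
  moreover have "\<dots>" by (rule has_sum_finiteI) auto
  ultimately show ?thesis
    unfolding cinner_tensor_product.rep_eq cinner_l2_def by (simp add: infsumI)
qed

text \<open>The operator \<open>tensor_with c\<close> is \<open>y \<mapsto> c \<otimes> y\<close>, and its adjoint extracts the coordinate of \<open>t\<close> with
  respect to a basis vector \<open>c\<close> of the first factor. Both kinds of coordinates share the coefficients
  \<open>\<langle>t, c \<otimes> b\<rangle>\<close>; summing first over \<open>c\<close> (Bessel) and then over \<open>b\<close> gives the bound.\<close>

lemma slices_norm_le:
  assumes "finite C" "C \<subseteq> (basis :: 'k set)"
  shows "(\<Sum>c\<in>C. (norm (adj (tensor_with c) t))\<^sup>2)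
    \<le> (norm (t :: ('k :: chilbert_space, 'h :: chilbert_space) tensor_product))\<^sup>2"
proof -
  have eq: "cinner (adj (tensor_with c) t) b = cinner (coord t b) c" if "b \<in> basis" for b :: 'h and c
    by (simp add: cinner_adj_left[OF tensor_with_bounded_ops] tensor_with_apply coord_eq_slice[OF that])
  have "((\<lambda>b. (cmod (cinner (coord t b) c))\<^sup>2) has_sum (norm (adj (tensor_with c) t))\<^sup>2) basis" for c
    using Parseval_norm[OF orthonormal_basis_basis, of "adj (tensor_with c) t"]
    by (rule has_sum_cong[THEN iffD1, rotated]) (simp add: eq)
  then have "((\<lambda>b. \<Sum>c\<in>C. (cmod (cinner (coord t b) c))\<^sup>2)
      has_sum (\<Sum>c\<in>C. (norm (adj (tensor_with c) t))\<^sup>2)) basis"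
    by (rule has_sum_finite_sum)
  moreover have "(\<Sum>c\<in>C. (cmod (cinner (coord t b) c))\<^sup>2) \<le> (norm (coord t b))\<^sup>2" for b
    using Bessel_finite[OF _ assms] orthonormal_basis_basis by (auto simp: orthonormal_basis_def)
  ultimately show ?thesis
    by (rule has_sum_mono_neutral[OF _ coord_norm_has_sum]) auto
qed

definition flip :: "('k :: chilbert_space, 'h :: chilbert_space) tensor_product \<Rightarrow>\<^sub>L
    ('h, 'k) tensor_product" where
  "flip = Blinfun (\<lambda>t. of_coords (\<lambda>c. if c \<in> basis then adj (tensor_with c) t else 0))"

lemma
  fixes t :: "('k :: chilbert_space, 'h :: chilbert_space) tensor_product"
  shows coord_flip: "coord (flip t) c = (if c \<in> basis then adj (tensor_with c) t else 0)"
    and norm_flip_le: "norm (flip t) \<le> norm t"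
proof -
  define f :: "('k, 'h) tensor_product \<Rightarrow> 'k \<Rightarrow> 'h"
    where "f t c = (if c \<in> basis then adj (tensor_with c) t else 0)" for t c
  define g where "g t = of_coords (f t)" for t
  have fin: "(\<Sum>c\<in>F. (norm (f t c))\<^sup>2) \<le> (norm t)\<^sup>2" if "finite F" for F t
  proof -
    have "(\<Sum>c\<in>F. (norm (f t c))\<^sup>2) = (\<Sum>c\<in>F \<inter> basis. (norm (adj (tensor_with c) t))\<^sup>2)"
      using that by (intro sum.mono_neutral_cong_right) (auto simp: f_def)
    also have "\<dots> \<le> (norm t)\<^sup>2" using that by (intro slices_norm_le) auto
    finally show ?thesis .
  qed
  then have "(\<lambda>c. (norm (f t c))\<^sup>2) summable_on UNIV" for t
    by (intro nonneg_bdd_above_summable_on) (auto intro!: bdd_aboveI2)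
  then have c: "coord (g t) c = f t c" for t c
    unfolding g_def by (rule coord_of_coords) (simp add: f_def)
  have le: "norm (g t) \<le> norm t" for t
  proof (rule power2_le_imp_le)
    show "(norm (g t))\<^sup>2 \<le> (norm t)\<^sup>2"
      by (rule has_sum_le_finite_sums[OF coord_norm_has_sum]) (simp only: c fin)
  qed simp
  have "bounded_linear g"
    by (rule bounded_linear_intro[where K = 1])
      (use le in \<open>auto intro!: tensor_eqI simp: c f_def blinfun.add_right blinfun.scaleR_right\<close>)
  then have "flip t = g t" for t
    by (simp add: flip_def bounded_linear_Blinfun_apply flip: g_def f_def)
  then show "coord (flip t) c = (if c \<in> basis then adj (tensor_with c) t else 0)"
    "norm (flip t) \<le> norm t"
    by (simp_all add: c f_def le)
qed

lemma flip_bounded_ops: "flip \<in> bounded_ops"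
  by (auto intro!: bounded_opsI tensor_eqI
      simp: coord_flip bounded_opsD adj_in_bounded_ops tensor_with_bounded_ops)

lemma flip_tensor: "flip (tensor x y) = tensor y x"
proof (rule tensor_eqI)
  have "adj (tensor_with c) (tensor x y) = cinner x c *\<^sub>C y" for c
    by (rule cinner_ext)
      (simp add: cinner_adj_left[OF tensor_with_bounded_ops] tensor_with_apply cinner_tensor
        cinner_scaleC_left)
  then show "coord (flip (tensor x y)) c = coord (tensor y x) c" for c
    by (simp add: coord_flip coord_tensor)
qed

definition right_op :: "('h :: chilbert_space \<Rightarrow>\<^sub>L 'l :: chilbert_space) \<Rightarrow>
    ('k :: chilbert_space, 'h) tensor_product \<Rightarrow>\<^sub>L ('k, 'l) tensor_product" where
  "right_op X = flip o\<^sub>L left_op X o\<^sub>L flip"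

lemma right_op_bounded_ops: "X \<in> bounded_ops \<Longrightarrow> right_op X \<in> bounded_ops"
  unfolding right_op_def by (intro bounded_ops_compose flip_bounded_ops left_op_bounded_ops)

lemma right_op_tensor: "X \<in> bounded_ops \<Longrightarrow> right_op X (tensor x y) = tensor x (X y)"
  by (simp add: right_op_def flip_tensor left_op_tensor)

text \<open>Exchanging the factors is contractive in both directions, so the row bound is inherited from the
  coordinatewise amplification.\<close>

lemma row_bound_right_op:
  assumes "row_bound F T c"
  shows "row_bound F (\<lambda>i. right_op (T i)) c"
  unfolding row_bound_def
proof
  fix y :: "_ \<Rightarrow> ('d, 'b) tensor_product"
  have "(norm (\<Sum>i\<in>F. right_op (T i) (y i)))\<^sup>2
      = (norm (flip (\<Sum>i\<in>F. left_op (T i) (flip (y i)))))\<^sup>2"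
    by (simp add: right_op_def blinfun.sum_right)
  also have "\<dots> \<le> (norm (\<Sum>i\<in>F. left_op (T i) (flip (y i))))\<^sup>2"
    by (intro power_mono norm_flip_le) simp
  also have "\<dots> \<le> c\<^sup>2 * (\<Sum>i\<in>F. (norm (flip (y i)))\<^sup>2)"
    by (rule row_boundD[OF row_bound_left_op[OF assms]])
  also have "\<dots> \<le> c\<^sup>2 * (\<Sum>i\<in>F. (norm (y i))\<^sup>2)"
    by (intro mult_left_mono sum_mono power_mono norm_flip_le) auto
  finally show "(norm (\<Sum>i\<in>F. right_op (T i) (y i)))\<^sup>2 \<le> c\<^sup>2 * (\<Sum>i\<in>F. (norm (y i))\<^sup>2)" .
qed

lemma bounded_ops_eq_on_tensors:
  fixes S T :: "('k :: chilbert_space, 'h :: chilbert_space) tensor_product \<Rightarrow>\<^sub>L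
    'l :: chilbert_space"
  assumes "S \<in> bounded_ops" "T \<in> bounded_ops" "\<And>x y. S (tensor x y) = T (tensor x y)"
  shows "S = T"
proof (rule blinfun_eqI, rule cinner_ext)
  fix t s
  have "adj S s - adj T s = 0"
    by (rule tensor_total)
      (simp add: cinner_diff_left cinner_adj_left assms)
  then show "cinner (S t) s = cinner (T t) s"
    by (simp add: cinner_adj assms(1,2))
qed

text \<open>This factorization both shows that the definite description of \<open>tensor_op\<close> denotes an operator and
  writes a sum of tensor products as a row times a column.\<close>

lemma tensor_op_eq:
  assumes "A \<in> bounded_ops" "X \<in> bounded_ops"
  shows "tensor_op A X = right_op X o\<^sub>L left_op A"
  unfolding tensor_op_def
proof (rule the_equality)
  show 1: "right_op X o\<^sub>L left_op A \<in> bounded_ops \<and>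
      (\<forall>x y. (right_op X o\<^sub>L left_op A) (tensor x y) = tensor (A x) (X y))"
    using assms by (simp add: bounded_ops_compose right_op_bounded_ops left_op_bounded_ops
        left_op_tensor right_op_tensor)
  show "T = right_op X o\<^sub>L left_op A"
    if "T \<in> bounded_ops \<and> (\<forall>x y. T (tensor x y) = tensor (A x) (X y))" for T
    using that 1 by (intro bounded_ops_eq_on_tensors) auto
qed

lemma tensor_op_tensor:
  assumes "A \<in> bounded_ops" "X \<in> bounded_ops"
  shows "tensor_op A X (tensor x y) = tensor (A x) (X y)"
  using assms by (simp add: tensor_op_eq left_op_tensor right_op_tensor)

theorem norm_sum_tensor_op_le:
  assumes A: "\<And>i. i \<in> F \<Longrightarrow> A i \<in> bounded_ops" and X: "\<And>i. i \<in> F \<Longrightarrow> X i \<in> bounded_ops"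
    and row: "row_bound F X c" and "0 \<le> c"
  shows "norm (\<Sum>i\<in>F. tensor_op (A i) (X i))
    \<le> c * sqrt (norm (\<Sum>i\<in>F. adj (A i) o\<^sub>L A i))"
proof (rule norm_blinfun_bound)
  define M where "M = norm (\<Sum>i\<in>F. adj (A i) o\<^sub>L A i)"
  show "norm ((\<Sum>i\<in>F. tensor_op (A i) (X i)) t)
      \<le> c * sqrt (norm (\<Sum>i\<in>F. adj (A i) o\<^sub>L A i)) * norm t" for t
  proof (rule power2_le_imp_le)
    have "(norm ((\<Sum>i\<in>F. tensor_op (A i) (X i)) t))\<^sup>2
        = (norm (\<Sum>i\<in>F. right_op (X i) (left_op (A i) t)))\<^sup>2"
      by (simp add: blinfun.sum_left tensor_op_eq A X)
    also have "\<dots> \<le> c\<^sup>2 * (\<Sum>i\<in>F. (norm (left_op (A i) t))\<^sup>2)"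
      by (rule row_boundD[OF row_bound_right_op[OF row]])
    also have "\<dots> \<le> c\<^sup>2 * (M * (norm t)\<^sup>2)"
      by (intro mult_left_mono column_bound_left_op) (auto simp: M_def column_bound[OF A])
    also have "\<dots> = (c * sqrt M * norm t)\<^sup>2"
      by (simp add: power_mult_distrib M_def)
    finally show "(norm ((\<Sum>i\<in>F. tensor_op (A i) (X i)) t))\<^sup>2
        \<le> (c * sqrt (norm (\<Sum>i\<in>F. adj (A i) o\<^sub>L A i)) * norm t)\<^sup>2"
      unfolding M_def .
  qed (use \<open>0 \<le> c\<close> in simp)
qed (use \<open>0 \<le> c\<close> in simp)

section \<open>Words in a row-bounded tuple\<close>

definition words_of_length :: "nat \<Rightarrow> nat \<Rightarrow> nat list set" where
  "words_of_length m p = {w. set w \<subseteq> {..<m} \<and> length w = p}"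

lemma bij_betw_Cons_words:
  "bij_betw (\<lambda>(j, w). j # w) ({..<m} \<times> words_of_length m p) (words_of_length m (Suc p))"
proof (rule bij_betw_byWitness[where f' = "\<lambda>w. (hd w, tl w)"])
  show "(\<lambda>w. (hd w, tl w)) ` words_of_length m (Suc p) \<subseteq> {..<m} \<times> words_of_length m p"
    by (auto simp: words_of_length_def length_Suc_conv)
qed (auto simp: words_of_length_def length_Suc_conv)

lemma multi_words_Nil: "multi_words_of_degree [] [] = {[]}"
  by (auto simp: multi_words_of_degree_def multi_words_def)

lemma multi_words_Cons:
  "w # \<alpha> \<in> multi_words (m # n) \<longleftrightarrow> set w \<subseteq> {..<m} \<and> \<alpha> \<in> multi_words n"
  by (auto simp: multi_words_def nth_Cons split: nat.splits)

lemma bij_betw_Cons_multi_words: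
  "bij_betw (\<lambda>(w, \<alpha>). w # \<alpha>) (words_of_length m p \<times> multi_words_of_degree n q)
    (multi_words_of_degree (m # n) (p # q))"
proof (rule bij_betw_byWitness[where f' = "\<lambda>\<alpha>. (hd \<alpha>, tl \<alpha>)"])
  have "\<alpha> \<noteq> []" if "\<alpha> \<in> multi_words_of_degree (m # n) (p # q)" for \<alpha>
    using that by (auto simp: multi_words_of_degree_def)
  then show "\<forall>\<alpha>\<in>multi_words_of_degree (m # n) (p # q).
      (case (hd \<alpha>, tl \<alpha>) of (w, \<alpha>) \<Rightarrow> w # \<alpha>) = \<alpha>"
    by auto
  show "(\<lambda>\<alpha>. (hd \<alpha>, tl \<alpha>)) ` multi_words_of_degree (m # n) (p # q)
      \<subseteq> words_of_length m p \<times> multi_words_of_degree n q"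
  proof safe
    fix \<alpha> assume \<alpha>: "\<alpha> \<in> multi_words_of_degree (m # n) (p # q)"
    then obtain w \<beta> where "\<alpha> = w # \<beta>" by (cases \<alpha>) (auto simp: multi_words_of_degree_def)
    with \<alpha> show "hd \<alpha> \<in> words_of_length m p" "tl \<alpha> \<in> multi_words_of_degree n q"
      by (auto simp: multi_words_of_degree_def words_of_length_def multi_words_Cons)
  qed
qed (auto simp: multi_words_of_degree_def words_of_length_def multi_words_Cons)

lemma finite_multi_words_of_degree: "finite (multi_words_of_degree n p)"
proof (cases "length p = length n")
  case True
  then show ?thesis
  proof (induction p n rule: list_induct2)
    case Nil
    then show ?case by (simp add: multi_words_Nil)
  next
    case (Cons p ps m n)
    have "finite (words_of_length m p)"
      unfolding words_of_length_def by (rule finite_lists_length_eq) simp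
    with Cons show ?case
      using bij_betw_finite[OF bij_betw_Cons_multi_words[of m p n ps]] by simp
  qed
next
  case False
  then have "multi_words_of_degree n p = {}"
    by (auto simp: multi_words_of_degree_def multi_words_def)
  then show ?thesis by simp
qed

lemma word_op_Nil: "word_op X i [] = id_blinfun"
  and word_op_Cons: "word_op X i (j # w) = X i j o\<^sub>L word_op X i w"
  by (simp_all add: word_op_def)

lemma multi_word_op_Nil: "multi_word_op X [] = id_blinfun"
  by (simp add: multi_word_op_def)

text \<open>The first word is evaluated in the first component of \<open>X\<close>; the shifted tuple makes statements about
  multi-words accessible to induction on the number of components.\<close>

lemma multi_word_op_Cons:
  "multi_word_op X (w # \<alpha>) = word_op X 0 w o\<^sub>L multi_word_op (\<lambda>i. X (Suc i)) \<alpha>"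
  by (simp add: multi_word_op_def word_op_def upt_conv_Cons foldr_map o_def
      del: upt_Suc flip: map_Suc_upt)

lemma word_op_bounded_ops:
  "(\<And>j. j \<in> set w \<Longrightarrow> X i j \<in> bounded_ops) \<Longrightarrow> word_op X i w \<in> bounded_ops"
  by (induction w) (auto simp: word_op_Nil word_op_Cons bounded_ops_id bounded_ops_compose)

lemma multi_word_op_bounded_ops:
  assumes "\<alpha> \<in> multi_words n" "\<And>i j. i < length n \<Longrightarrow> j < n ! i \<Longrightarrow> X i j \<in> bounded_ops"
  shows "multi_word_op X \<alpha> \<in> bounded_ops"
  using assms
proof (induction n arbitrary: \<alpha> X)
  case Nil
  then show ?case by (simp add: multi_words_def multi_word_op_Nil bounded_ops_id)
next
  case (Cons m n)
  from Cons.prems(1) obtain w \<beta> where \<alpha>: "\<alpha> = w # \<beta>"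
    by (cases \<alpha>) (auto simp: multi_words_def)
  have "word_op X 0 w \<in> bounded_ops"
    using Cons.prems by (intro word_op_bounded_ops) (auto simp: \<alpha> multi_words_Cons subset_iff)
  moreover have "multi_word_op (\<lambda>i. X (Suc i)) \<beta> \<in> bounded_ops"
    using Cons.prems by (intro Cons.IH) (auto simp: \<alpha> multi_words_Cons)
  ultimately show ?case by (simp add: \<alpha> multi_word_op_Cons bounded_ops_compose)
qed

lemma row_bound_words:
  assumes "row_bound {..<m} (X i) r"
  shows "row_bound (words_of_length m p) (word_op X i) (r ^ p)"
proof (induction p)
  case 0
  have "words_of_length m 0 = {[]}" by (auto simp: words_of_length_def)
  then show ?case by (simp add: row_bound_def word_op_Nil)
next
  case (Suc p)
  show ?case
    by (rule row_bound_reindex[OF bij_betw_Cons_words])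
      (use row_bound_product[OF assms Suc] in
        \<open>simp add: case_prod_unfold word_op_Cons\<close>)
qed

text \<open>The row of all \<open>X\<^sub>\<alpha>\<close> of multi-degree \<open>p\<close> is the product over \<open>i\<close> of the rows of all words of
  length \<open>p\<^sub>i\<close>, and each of these is a \<open>p\<^sub>i\<close>-fold product of the row \<open>X\<^sub>i\<close>.\<close>

lemma row_bound_multi_words:
  assumes "length p = length n" "\<And>i. i < length n \<Longrightarrow> row_bound {..<n ! i} (X i) r"
  shows "row_bound (multi_words_of_degree n p) (multi_word_op X) (r ^ sum_list p)"
  using assms
proof (induction p n arbitrary: X rule: list_induct2)
  case Nil
  then show ?case by (simp add: row_bound_def multi_words_Nil multi_word_op_Nil)
next
  case (Cons p ps m n)
  have "row_bound {..<m} (X 0) r" using Cons.prems[of 0] by simp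
  then have "row_bound (words_of_length m p) (word_op X 0) (r ^ p)"
    by (rule row_bound_words)
  moreover have "row_bound (multi_words_of_degree n ps) (multi_word_op (\<lambda>i. X (Suc i)))
      (r ^ sum_list ps)"
    using Cons.prems[of "Suc _"] by (intro Cons.IH) simp
  ultimately show ?case
    by (intro row_bound_reindex[OF bij_betw_Cons_multi_words])
      (use row_bound_product in \<open>fastforce simp: case_prod_unfold multi_word_op_Cons power_add\<close>)
qed

text \<open>The square of the norm of the column of coefficients of multi-degree \<open>p\<close>.\<close>

definition column_norm ::
  "nat list \<Rightarrow> (nat list list \<Rightarrow> 'k :: chilbert_space \<Rightarrow>\<^sub>L 'k) \<Rightarrow> nat list \<Rightarrow> real" where
  "column_norm n A p = norm (\<Sum>\<alpha>\<in>multi_words_of_degree n p. adj (A \<alpha>) o\<^sub>L A \<alpha>)"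

lemma column_norm_nonneg: "0 \<le> column_norm n A p"
  by (simp add: column_norm_def)

lemma norm_homogeneous_part_le:
  assumes A: "\<forall>\<alpha>\<in>multi_words n. A \<alpha> \<in> bounded_ops"
    and X: "\<And>i j. i < length n \<Longrightarrow> j < n ! i \<Longrightarrow> X i j \<in> bounded_ops"
    and row: "\<And>i. i < length n \<Longrightarrow> row_bound {..<n ! i} (X i) r"
    and "0 \<le> r" "p \<in> multi_degrees n"
  shows "norm (homogeneous_part n A X p) \<le> r ^ sum_list p * sqrt (column_norm n A p)"
  unfolding homogeneous_part_def column_norm_def
proof (rule norm_sum_tensor_op_le)
  show "row_bound (multi_words_of_degree n p) (multi_word_op X) (r ^ sum_list p)"
    using assms by (intro row_bound_multi_words) (auto simp: multi_degrees_def)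
qed (use assms in \<open>auto simp: multi_words_of_degree_def intro!: multi_word_op_bounded_ops\<close>)

section \<open>Geometric series over multi-degrees\<close>

lemma summable_on_power_sum_list:
  assumes "0 \<le> q" "q < (1 :: real)"
  shows "(\<lambda>p. q ^ sum_list p) summable_on {p :: nat list. length p = k}"
proof (induction k)
  case 0
  have "{p :: nat list. length p = 0} = {[]}" by auto
  then show ?case by simp
next
  case (Suc k)
  have "(\<lambda>n. q ^ n) summable_on (UNIV :: nat set)"
    using assms by (intro norm_summable_imp_summable_on) (simp add: summable_geometric)
  then have geom: "(\<lambda>n. q ^ n * (\<Sum>\<^sub>\<infinity>p\<in>{p :: nat list. length p = k}. q ^ sum_list p)) summable_on UNIV"
    by (rule summable_on_cmult_left)
  have "(\<lambda>x. q ^ fst x * q ^ sum_list (snd x)) summable_on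
      (UNIV :: nat set) \<times> {p :: nat list. length p = k}"
    by (rule summable_on_SigmaI[OF _ geom])
      (use Suc assms(1) in \<open>auto intro: has_sum_cmult_right\<close>)
  also have "?this \<longleftrightarrow> (\<lambda>p. q ^ sum_list p) summable_on {p :: nat list. length p = Suc k}"
    by (rule summable_on_reindex_bij_witness[where i = "\<lambda>p. (hd p, tl p)"
          and j = "\<lambda>(a, p). a # p"])
      (auto simp: length_Suc_conv power_add)
  finally show ?case .
qed

lemma finite_degrees_le: "finite {p \<in> multi_degrees n. sum_list p \<le> N}"
proof (rule finite_subset)
  show "{p \<in> multi_degrees n. sum_list p \<le> N} \<subseteq> {p. set p \<subseteq> {..N} \<and> length p = length n}"
    using member_le_sum_list by (fastforce simp: multi_degrees_def)
qed (rule finite_lists_length_eq, simp)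

text \<open>Only finitely many multi-degrees have total degree below \<open>N\<close>. With \<open>N = 1\<close> this discards \<open>p = 0\<close>,
  where the root in the definition of \<open>\<gamma>\<close> is meaningless.\<close>

lemma eventually_multi_degrees_sum_list_ge:
  "\<forall>\<^sub>F p in inf cofinite (principal (multi_degrees n)). N \<le> sum_list p"
  unfolding eventually_inf_principal eventually_cofinite
  by (rule finite_subset[OF _ finite_degrees_le[of n N]]) auto

lemma powr_half_inverse_le_iff:
  assumes "0 \<le> c" "0 < b" "0 < N"
  shows "c powr (1 / (2 * real N)) \<le> b \<longleftrightarrow> sqrt c \<le> b ^ N"
proof -
  have "c powr (1 / (2 * real N)) = sqrt c powr (1 / real N)" "b = (b ^ N) powr (1 / real N)"
    using assms by (simp_all add: powr_powr flip: powr_half_sqrt powr_realpow)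
  moreover have "sqrt c powr (1 / real N) \<le> (b ^ N) powr (1 / real N) \<longleftrightarrow> sqrt c \<le> b ^ N"
    using assms powr_mono2[of "1 / real N" "sqrt c" "b ^ N"]
      powr_less_mono2[of "1 / real N" "b ^ N" "sqrt c"] by (fastforce simp: not_le)
  ultimately show ?thesis by simp
qed

lemma one_divide_less_ennreal:
  assumes "ennreal r < \<gamma>" "0 < r"
  shows "1 / \<gamma> < ennreal (1 / r)"
proof (cases \<gamma>)
  case (real g)
  then show ?thesis
    using assms by (simp add: ennreal_less_iff divide_ennreal ennreal_1[symmetric] frac_less2 del: ennreal_1)
next
  case top
  then show ?thesis using assms by simp
qed

lemma less_one_divide_ennreal:
  assumes "\<gamma> < ennreal s"
  shows "ennreal (1 / s) < 1 / \<gamma>"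
proof (cases \<gamma>)
  case (real g)
  then have "g < s" "0 \<le> g" using assms by (simp_all add: ennreal_less_iff)
  then show ?thesis
    using assms real by (cases "g = 0")
     (simp_all add: divide_ennreal ennreal_1[symmetric] ennreal_less_iff frac_less2 del: ennreal_1)
qed (use assms in simp)

text \<open>The root test. A radius \<open>\<rho>\<close> strictly between \<open>r\<close> and \<open>\<gamma>\<close> satisfies \<open>1/\<gamma> < 1/\<rho>\<close>. So the roots of the
  coefficients are eventually below \<open>1/\<rho>\<close>, and the terms are dominated by powers of \<open>r/\<rho> < 1\<close>.\<close>

lemma summable_on_radius:
  fixes c :: "nat list \<Rightarrow> real"
  assumes c: "\<And>p. 0 \<le> c p"
    and \<gamma>: "1 / \<gamma> = multi_limsup n (\<lambda>p. ennreal (c p powr (1 / (2 * real (sum_list p)))))"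
    and r: "0 \<le> r" "ennreal r < \<gamma>"
  shows "(\<lambda>p. r ^ sum_list p * sqrt (c p)) summable_on multi_degrees n"
proof -
  obtain z where z: "ennreal r < z" "z < \<gamma>" using dense[OF r(2)] by blast
  define \<rho> where "\<rho> = enn2real z"
  have z\<rho>: "z = ennreal \<rho>"
    using z by (auto simp: \<rho>_def less_top[symmetric] dest: order.strict_trans2[OF _ top_greatest])
  have \<rho>: "r < \<rho>" using z r by (simp add: z\<rho> ennreal_less_iff)
  let ?Fil = "inf cofinite (principal (multi_degrees n))"
  have "multi_limsup n (\<lambda>p. ennreal (c p powr (1 / (2 * real (sum_list p))))) < ennreal (1 / \<rho>)"
    unfolding \<gamma>[symmetric] using z \<rho> r by (intro one_divide_less_ennreal) (auto simp: z\<rho>)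
  then have "\<forall>\<^sub>F p in ?Fil. ennreal (c p powr (1 / (2 * real (sum_list p)))) < ennreal (1 / \<rho>)"
    unfolding multi_limsup_def by (rule Limsup_lessD)
  with eventually_multi_degrees_sum_list_ge[of 1 n]
  have "\<forall>\<^sub>F p in ?Fil. r ^ sum_list p * sqrt (c p) \<le> (r / \<rho>) ^ sum_list p"
  proof eventually_elim
    case (elim p)
    have "sqrt (c p) \<le> (1 / \<rho>) ^ sum_list p"
      using elim \<rho> r c by (subst powr_half_inverse_le_iff[symmetric]) (auto simp: ennreal_less_iff)
    then have "r ^ sum_list p * sqrt (c p) \<le> r ^ sum_list p * (1 / \<rho>) ^ sum_list p"
      using r by (intro mult_left_mono) auto
    then show ?case by (simp add: power_divide)
  qed
  then have fin: "finite {p \<in> multi_degrees n. \<not> r ^ sum_list p * sqrt (c p) \<le> (r / \<rho>) ^ sum_list p}"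
      (is "finite ?E")
    by (simp add: eventually_inf_principal eventually_cofinite)
  have "(\<lambda>p. r ^ sum_list p * sqrt (c p)) summable_on (multi_degrees n - ?E)"
  proof (rule summable_on_comparison_test)
    show "(\<lambda>p. (r / \<rho>) ^ sum_list p) summable_on (multi_degrees n - ?E)"
      using summable_on_power_sum_list[of "r / \<rho>" "length n"] \<rho> r
      by (auto intro!: summable_on_subset_banach[OF summable_on_power_sum_list[of "r / \<rho>" "length n"]]
          simp: multi_degrees_def)
  qed (use r c in auto)
  moreover have "(\<lambda>p. r ^ sum_list p * sqrt (c p)) summable_on ?E"
    using fin by (rule summable_on_finite)
  ultimately have "(\<lambda>p. r ^ sum_list p * sqrt (c p)) summable_on (multi_degrees n - ?E) \<union> ?E"
    by (rule summable_on_Un_disjoint) auto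
  moreover have "(multi_degrees n - ?E) \<union> ?E = multi_degrees n" by auto
  ultimately show ?thesis by simp
qed

section \<open>Weighted composition operators\<close>

text \<open>Composition with a map \<open>g\<close>, followed by multiplication with \<open>w\<close>. The map \<open>g\<close> matters only where
  \<open>w\<close> is nonzero, so partial injections are covered. Creation operators, their adjoints and diagonal
  operators all have this form, and their boundedness is proved once.\<close>

definition weighted_comp :: "(nat \<Rightarrow> real) \<Rightarrow> (nat \<Rightarrow> nat) \<Rightarrow>
    (nat, complex) l2 \<Rightarrow>\<^sub>L (nat, complex) l2" where
  "weighted_comp w g = Blinfun (\<lambda>f. Abs_l2 (\<lambda>m. w m *\<^sub>R l2_apply f (g m)))"

text \<open>Injectivity of \<open>g\<close> on the support of \<open>w\<close> ensures that no entry of \<open>f\<close> is counted twice in the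
  norm of the image.\<close>

lemma
  assumes inj: "inj_on g {m. w m \<noteq> 0}" and w: "\<And>m. \<bar>w m\<bar> \<le> K"
  shows weighted_comp_apply: "l2_apply (weighted_comp w g f) m = w m *\<^sub>R l2_apply f (g m)"
    and norm_weighted_comp_le: "norm (weighted_comp w g) \<le> K"
proof -
  have "0 \<le> K" using w[of 0] by linarith
  define h where "h f = Abs_l2 (\<lambda>m. w m *\<^sub>R l2_apply f (g m))" for f :: "(nat, complex) l2"
  have fin: "(\<Sum>m\<in>F. (norm (w m *\<^sub>R l2_apply f (g m)))\<^sup>2) \<le> (K * norm f)\<^sup>2"
    if F: "finite F" for F and f :: "(nat, complex) l2"
  proof -
    have "(\<Sum>m\<in>F. (norm (w m *\<^sub>R l2_apply f (g m)))\<^sup>2)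
        = (\<Sum>m\<in>F \<inter> {m. w m \<noteq> 0}. (norm (w m *\<^sub>R l2_apply f (g m)))\<^sup>2)"
      using F by (intro sum.mono_neutral_right) auto
    also have "\<dots> \<le> (\<Sum>m\<in>F \<inter> {m. w m \<noteq> 0}. K\<^sup>2 * (norm (l2_apply f (g m)))\<^sup>2)"
      using w by (intro sum_mono) (auto simp: power_mult_distrib abs_le_square_iff[symmetric]
          intro!: mult_right_mono power2_le_iff_abs_le[THEN iffD2] \<open>0 \<le> K\<close>)
    also have "\<dots> = K\<^sup>2 * (\<Sum>m\<in>F \<inter> {m. w m \<noteq> 0}. (norm (l2_apply f (g m)))\<^sup>2)"
      by (simp add: sum_distrib_left)
    also have "(\<Sum>m\<in>F \<inter> {m. w m \<noteq> 0}. (norm (l2_apply f (g m)))\<^sup>2)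
        = (\<Sum>l\<in>g ` (F \<inter> {m. w m \<noteq> 0}). (norm (l2_apply f l))\<^sup>2)"
      using inj by (subst sum.reindex) (auto intro: inj_on_subset)
    also have "\<dots> \<le> (norm f)\<^sup>2"
      using F by (intro finite_sum_le_has_sum[OF l2_norm_has_sum]) auto
    finally show ?thesis by (simp add: power_mult_distrib mult_left_mono)
  qed
  have "(\<lambda>m. (norm (w m *\<^sub>R l2_apply f (g m)))\<^sup>2) summable_on UNIV" for f :: "(nat, complex) l2"
    by (intro nonneg_bdd_above_summable_on bdd_aboveI2[where M = "(K * norm f)\<^sup>2"])
      (auto intro: fin simp del: norm_scaleR)
  then have h: "l2_apply (h f) m = w m *\<^sub>R l2_apply f (g m)" for f m
    unfolding h_def by (subst Abs_l2_inverse) auto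
  have le: "norm (h f) \<le> K * norm f" for f
  proof (rule power2_le_imp_le)
    show "(norm (h f))\<^sup>2 \<le> (K * norm f)\<^sup>2"
      by (rule has_sum_le_finite_sums[OF l2_norm_has_sum]) (simp only: h fin)
  qed (use \<open>0 \<le> K\<close> in simp)
  have "bounded_linear h"
    by (rule bounded_linear_intro[where K = K])
      (use le in \<open>auto intro!: l2_eqI simp: h algebra_simps\<close>)
  then have eq: "weighted_comp w g f = h f" for f
    by (simp add: weighted_comp_def bounded_linear_Blinfun_apply flip: h_def)
  show "l2_apply (weighted_comp w g f) m = w m *\<^sub>R l2_apply f (g m)"
    by (simp add: eq h)
  show "norm (weighted_comp w g) \<le> K"
    using \<open>0 \<le> K\<close> by (intro norm_blinfun_bound) (simp_all add: eq le)
qed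

lemma weighted_comp_bounded_ops:
  assumes "inj_on g {m. w m \<noteq> 0}" "\<And>m. \<bar>w m\<bar> \<le> K"
  shows "weighted_comp w g \<in> bounded_ops"
  by (rule bounded_opsI, rule l2_eqI) (simp add: weighted_comp_apply[OF assms] scaleC_complex_def)

definition diag :: "(nat \<Rightarrow> real) \<Rightarrow> (nat, complex) l2 \<Rightarrow>\<^sub>L (nat, complex) l2" where
  "diag d = weighted_comp d id"

lemma diag_apply: "(\<And>m. \<bar>d m\<bar> \<le> K) \<Longrightarrow> l2_apply (diag d f) m = d m *\<^sub>R l2_apply f m"
  unfolding diag_def by (subst weighted_comp_apply) auto

lemma norm_diag_le: "(\<And>m. \<bar>d m\<bar> \<le> K) \<Longrightarrow> norm (diag d) \<le> K"
  unfolding diag_def by (rule norm_weighted_comp_le) auto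

lemma diag_bounded_ops: "(\<And>m. \<bar>d m\<bar> \<le> K) \<Longrightarrow> diag d \<in> bounded_ops"
  unfolding diag_def by (rule weighted_comp_bounded_ops) auto

lemma diag_one: "diag (\<lambda>m. 1) = id_blinfun"
  by (rule blinfun_eqI, rule l2_eqI) (simp add: diag_apply[of _ 1])

text \<open>The lower bound \<open>\<delta>\<close> keeps the inverse diagonal bounded.\<close>

lemma positive_invertible_diag:
  assumes "0 < \<delta>" "\<And>m. \<delta> \<le> d m" "\<And>m. d m \<le> 1"
  shows "positive_invertible (diag d)"
proof -
  have d: "0 < d m" for m using assms(1) assms(2)[of m] by linarith
  have K: "\<bar>d m\<bar> \<le> 1" "\<bar>1 / d m\<bar> \<le> 1 / \<delta>" for m
    using assms(1) assms(2,3)[of m] d[of m] by (auto simp: frac_le)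
  have "cinner (diag d f) f \<in> \<real>\<^sub>\<ge>\<^sub>0" for f
  proof -
    have "cinner (diag d f) f = (\<Sum>\<^sub>\<infinity>m. complex_of_real (d m * (norm (l2_apply f m))\<^sup>2))"
      unfolding cinner_l2_def
      by (simp add: diag_apply[OF K(1)] cinner_complex_def scaleR_conv_of_real mult.assoc
          complex_norm_square del: of_real_power)
    also have "\<dots> = complex_of_real (\<Sum>\<^sub>\<infinity>m. d m * (norm (l2_apply f m))\<^sup>2)"
    proof (rule infsumI, rule has_sum_of_real, rule has_sum_infsum)
      show "(\<lambda>m. d m * (norm (l2_apply f m))\<^sup>2) summable_on UNIV"
        by (rule summable_on_comparison_test[OF l2_summable[of f]])
          (simp_all add: mult_left_le_one_le assms(3) d less_imp_le)
    qed
    finally show ?thesis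
      using d by (simp add: infsum_nonneg less_imp_le)
  qed
  moreover have "diag (\<lambda>m. 1 / d m) \<in> bounded_ops"
    by (rule diag_bounded_ops[OF K(2)])
  moreover have "diag d o\<^sub>L diag (\<lambda>m. 1 / d m) = id_blinfun"
    "diag (\<lambda>m. 1 / d m) o\<^sub>L diag d = id_blinfun"
    using d[THEN less_imp_neq] by (auto intro!: blinfun_eqI l2_eqI
        simp: diag_apply[OF K(1)] diag_apply[OF K(2)])
  ultimately show ?thesis unfolding positive_invertible_def by blast
qed

section \<open>The universal model\<close>

text \<open>The model acts on sequences indexed by \<open>nat\<close>, so multi-words are encoded as numbers. The encoding
  is a bijection from all lists of lists. Lists that are not multi-words (because of their length or
  their letters) only contribute a direct summand.\<close>

definition enc :: "nat list list \<Rightarrow> nat" where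
  "enc \<beta> = list_encode (map list_encode \<beta>)"

definition dec :: "nat \<Rightarrow> nat list list" where
  "dec m = map list_decode (list_decode m)"

lemma dec_enc [simp]: "dec (enc \<beta>) = \<beta>"
  by (simp add: dec_def enc_def o_def)

lemma enc_dec [simp]: "enc (dec m) = m"
  by (simp add: dec_def enc_def o_def)

lemma enc_eq_iff [simp]: "enc \<alpha> = enc \<beta> \<longleftrightarrow> \<alpha> = \<beta>"
  by (metis dec_enc)

definition begins :: "nat \<Rightarrow> nat \<Rightarrow> nat list list \<Rightarrow> bool" where
  "begins i j \<beta> \<longleftrightarrow> i < length \<beta> \<and> \<beta> ! i \<noteq> [] \<and> hd (\<beta> ! i) = j"

text \<open>The \<open>m\<close>-th entry of \<open>S\<^sub>i\<^sub>,\<^sub>j f\<close> is the entry of \<open>f\<close> at the multi-word from which \<open>m\<close> arises by putting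
  \<open>j\<close> in front of the \<open>i\<close>-th word, and \<open>0\<close> if there is none.\<close>

definition creation :: "nat \<Rightarrow> nat \<Rightarrow> (nat, complex) l2 \<Rightarrow>\<^sub>L (nat, complex) l2" where
  "creation i j = weighted_comp (\<lambda>m. of_bool (begins i j (dec m)))
    (\<lambda>m. enc ((dec m)[i := tl (dec m ! i)]))"

definition annihilation :: "nat \<Rightarrow> nat \<Rightarrow> (nat, complex) l2 \<Rightarrow>\<^sub>L (nat, complex) l2" where
  "annihilation i j = weighted_comp (\<lambda>m. of_bool (i < length (dec m)))
    (\<lambda>m. enc ((dec m)[i := j # dec m ! i]))"

lemma begins_update_tl:
  "begins i j \<beta> \<Longrightarrow> \<beta>[i := tl (\<beta> ! i), i := j # tl (\<beta> ! i)] = \<beta>"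
  by (auto simp: begins_def)

lemma inj_on_creation:
  "inj_on (\<lambda>m. enc ((dec m)[i := tl (dec m ! i)])) {m. of_bool (begins i j (dec m)) \<noteq> (0 :: real)}"
proof (rule inj_on_inverseI)
  fix m assume "m \<in> {m. of_bool (begins i j (dec m)) \<noteq> (0 :: real)}"
  then have "begins i j (dec m)" by simp
  then show "(\<lambda>l. enc ((dec l)[i := j # dec l ! i])) (enc ((dec m)[i := tl (dec m ! i)])) = m"
    using begins_update_tl[of i j "dec m"] by (simp add: begins_def)
qed

lemma inj_on_annihilation:
  "inj_on (\<lambda>m. enc ((dec m)[i := j # dec m ! i])) {m. of_bool (i < length (dec m)) \<noteq> (0 :: real)}"
  by (rule inj_on_inverseI[where g = "\<lambda>l. enc ((dec l)[i := tl (dec l ! i)])"]) auto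

lemma creation_apply:
  "l2_apply (creation i j f) m =
    (if begins i j (dec m) then l2_apply f (enc ((dec m)[i := tl (dec m ! i)])) else 0)"
  unfolding creation_def by (subst weighted_comp_apply[OF inj_on_creation, of _ _ 1]) auto

lemma annihilation_apply:
  "l2_apply (annihilation i j f) m =
    (if i < length (dec m) then l2_apply f (enc ((dec m)[i := j # dec m ! i])) else 0)"
  unfolding annihilation_def by (subst weighted_comp_apply[OF inj_on_annihilation, of _ 1]) auto

lemma creation_bounded_ops: "creation i j \<in> bounded_ops"
  unfolding creation_def by (rule weighted_comp_bounded_ops[OF inj_on_creation, of _ _ 1]) auto

text \<open>Removing and adding the letter \<open>j\<close> are inverse bijections between the supports of the two
  operators, so the two sums differ by a change of the summation index.\<close>

lemma cinner_creation: "cinner (creation i j f) g = cinner f (annihilation i j g)"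
proof -
  have "cinner (creation i j f) g = (\<Sum>\<^sub>\<infinity>m\<in>{m. begins i j (dec m)}.
      l2_apply f (enc ((dec m)[i := tl (dec m ! i)])) * cnj (l2_apply g m))"
    unfolding cinner_l2_def
    by (rule infsum_cong_neutral) (auto simp: creation_apply cinner_complex_def)
  also have "\<dots> = (\<Sum>\<^sub>\<infinity>l\<in>{l. i < length (dec l)}.
      l2_apply f l * cnj (l2_apply g (enc ((dec l)[i := j # dec l ! i]))))"
    by (rule infsum_reindex_bij_witness[where i = "\<lambda>l. enc ((dec l)[i := j # dec l ! i])"
          and j = "\<lambda>m. enc ((dec m)[i := tl (dec m ! i)])"])
      (use begins_update_tl in \<open>auto simp: begins_def\<close>)
  also have "\<dots> = cinner f (annihilation i j g)"
    unfolding cinner_l2_def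
    by (rule infsum_cong_neutral) (auto simp: annihilation_apply cinner_complex_def)
  finally show ?thesis .
qed

lemma adj_scaleR_creation: "adj (r *\<^sub>R creation i j) = r *\<^sub>R annihilation i j"
  by (rule adj_eqI)
    (simp add: scaleR_blinfun.rep_eq scaleR_eq_scaleC cinner_scaleC_left cinner_scaleC_right
      cinner_creation)

lemma creation_commute:
  assumes "s \<noteq> t"
  shows "creation s i o\<^sub>L creation t j = creation t j o\<^sub>L creation s i"
proof (rule blinfun_eqI, rule l2_eqI)
  fix f m
  have "begins s i ((dec m)[t := w]) = begins s i (dec m)"
    "begins t j ((dec m)[s := w]) = begins t j (dec m)" for w
    using assms by (simp_all add: begins_def)
  then show "l2_apply ((creation s i o\<^sub>L creation t j) f) m
      = l2_apply ((creation t j o\<^sub>L creation s i) f) m"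
    using assms by (simp add: creation_apply list_update_swap[OF assms])
qed

definition model :: "nat list \<Rightarrow> real \<Rightarrow> (nat, complex) l2 op_tuple" where
  "model n r = (\<lambda>i j. if i < length n \<and> j < n ! i then r *\<^sub>R creation i j else 0)"

lemma scale_tuple_model: "scale_tuple s (model n r) = model n (s * r)"
  by (auto simp: scale_tuple_def model_def fun_eq_iff)

lemma model_commuting: "model n r \<in> commuting_tuples n"
  by (auto simp: commuting_tuples_def model_def bounded_ops_scaleR creation_bounded_ops
      bounded_bilinear.scaleR_left[OF bounded_bilinear_blinfun_compose]
      bounded_bilinear.scaleR_right[OF bounded_bilinear_blinfun_compose] creation_commute)

text \<open>The projection onto these multi-words is \<open>\<Sum>\<^sub>j S\<^sub>i\<^sub>,\<^sub>j S\<^sub>i\<^sub>,\<^sub>j\<^sup>*\<close>, where \<open>j\<close> ranges over the letters of the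
  \<open>i\<close>-th alphabet.\<close>

definition begins_within :: "nat list \<Rightarrow> nat \<Rightarrow> nat list list \<Rightarrow> bool" where
  "begins_within n i \<beta> \<longleftrightarrow> i < length \<beta> \<and> \<beta> ! i \<noteq> [] \<and> hd (\<beta> ! i) < n ! i"

text \<open>A diagonal whose entries do not depend on the \<open>i\<close>-th word commutes with every \<open>S\<^sub>i\<^sub>,\<^sub>j\<close>, so it
  can be pulled out of the sum \<open>\<Sum>\<^sub>j r\<^sup>2 S\<^sub>i\<^sub>,\<^sub>j D S\<^sub>i\<^sub>,\<^sub>j\<^sup>*\<close>. At a given multi-word at most one \<open>j\<close> contributes,
  namely the first letter of its \<open>i\<close>-th word.\<close>

lemma cp_map_model_diag:
  assumes "i < length n" "\<And>m. \<bar>d m\<bar> \<le> K"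
    and inv: "\<And>\<beta> w. d (enc (\<beta>[i := w])) = d (enc \<beta>)"
  shows "cp_map n (model n r) i (diag d)
    = diag (\<lambda>m. r\<^sup>2 * of_bool (begins_within n i (dec m)) * d m)"
proof (rule blinfun_eqI, rule l2_eqI)
  fix f m
  have "0 \<le> K" using assms(2)[of 0] by linarith
  have K: "\<bar>r\<^sup>2 * of_bool (begins_within n i (dec m)) * d m\<bar> \<le> r\<^sup>2 * K" for m
    using assms(2)[of m] \<open>0 \<le> K\<close> by (auto simp: abs_mult intro!: mult_left_mono)
  have summand: "l2_apply ((model n r i j o\<^sub>L diag d o\<^sub>L adj (model n r i j)) f) m
      = (if begins i j (dec m) then (r\<^sup>2 * d m) *\<^sub>R l2_apply f m else 0)" if "j < n ! i" for j
  proof (cases "begins i j (dec m)")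
    case True
    then have "i < length (dec m)" by (simp add: begins_def)
    then show ?thesis
      using True begins_update_tl[OF True] inv[of "dec m"] that assms(1)
      by (simp add: model_def adj_scaleR_creation scaleR_blinfun.rep_eq creation_apply
          annihilation_apply diag_apply[OF assms(2)] power2_eq_square blinfun.scaleR_right)
  next
    case False
    then show ?thesis
      using that assms(1) by (simp add: model_def scaleR_blinfun.rep_eq creation_apply)
  qed
  have "l2_apply (cp_map n (model n r) i (diag d) f) m
      = (\<Sum>j<n ! i. l2_apply ((model n r i j o\<^sub>L diag d o\<^sub>L adj (model n r i j)) f) m)"
  proof -
    have "l2_apply (\<Sum>j\<in>J. g j) m = (\<Sum>j\<in>J. l2_apply (g j) m)"
      for J :: "nat set" and g :: "nat \<Rightarrow> (nat, complex) l2"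
      by (induction J rule: infinite_finite_induct) auto
    then show ?thesis by (simp only: cp_map_def blinfun.sum_left)
  qed
  also have "\<dots> = (\<Sum>j<n ! i. if begins i j (dec m) then (r\<^sup>2 * d m) *\<^sub>R l2_apply f m else 0)"
    by (intro sum.cong summand) auto
  also have "\<dots> = (\<Sum>j<n ! i. if j = hd (dec m ! i) then
      (if i < length (dec m) \<and> dec m ! i \<noteq> [] then (r\<^sup>2 * d m) *\<^sub>R l2_apply f m else 0) else 0)"
    by (intro sum.cong) (auto simp: begins_def)
  also have "\<dots> = l2_apply (diag (\<lambda>m. r\<^sup>2 * of_bool (begins_within n i (dec m)) * d m) f) m"
    unfolding diag_apply[OF K] by (simp add: begins_within_def)
  finally show "l2_apply (cp_map n (model n r) i (diag d) f) m
      = l2_apply (diag (\<lambda>m. r\<^sup>2 * of_bool (begins_within n i (dec m)) * d m) f) m" .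
qed

lemma diag_diff:
  assumes "\<And>m. \<bar>d m\<bar> \<le> K" "\<And>m. \<bar>e m\<bar> \<le> L"
  shows "diag d - diag e = diag (\<lambda>m. d m - e m)"
proof (rule blinfun_eqI, rule l2_eqI)
  have "\<bar>d m - e m\<bar> \<le> K + L" for m
    using assms[of m] by linarith
  then show "l2_apply ((diag d - diag e) f) m = l2_apply (diag (\<lambda>m. d m - e m) f) m" for f m
    by (simp add: diag_apply[of _ "K + L"] diag_apply[OF assms(1)] diag_apply[OF assms(2)]
        blinfun.diff_left scaleR_diff_left)
qed

text \<open>The defect is computed one component at a time. After the components \<open>q, q + 1, \<dots>\<close> the operator is the
  diagonal \<open>D q\<close>. Its entries do not depend on the word with index \<open>q - 1\<close>, so the next component
  just multiplies them by \<open>1 - r\<^sup>2\<close> or \<open>1\<close>. All entries are at least \<open>(1 - r\<^sup>2)\<^sup>k\<close>.\<close>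

lemma model_in_polyball:
  assumes "0 \<le> r" "r < 1"
  shows "model n r \<in> polyball n"
proof -
  define k where "k = length n"
  define D where "D q m = (\<Prod>i\<in>{q..<k}. 1 - r\<^sup>2 * of_bool (begins_within n i (dec m)))" for q m
  have r2: "0 \<le> r\<^sup>2" "r\<^sup>2 < 1"
    using assms by (simp_all add: power_less_one_iff abs_square_less_1)
  have factor: "1 - r\<^sup>2 \<le> 1 - r\<^sup>2 * of_bool b" "1 - r\<^sup>2 * of_bool b \<le> 1"
    "0 \<le> 1 - r\<^sup>2 * of_bool b" for b
    using r2 by (auto simp: of_bool_def)
  have D1: "D q m \<le> 1" and D0: "0 \<le> D q m" for q m
    unfolding D_def using factor by (auto intro!: prod_le_1 prod_nonneg)
  have DK: "\<bar>D q m\<bar> \<le> 1" for q m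
    using D1[of q m] D0[of q m] by simp
  have eK: "\<bar>r\<^sup>2 * of_bool (begins_within n i (dec m)) * D q m\<bar> \<le> 1" for i q m
    using DK[of q m] r2 by (auto simp: abs_mult of_bool_def intro: mult_le_one)
  have "foldr (\<lambda>i Y. Y - cp_map n (model n r) i Y) [q..<k] id_blinfun = diag (D q)" if "q \<le> k" for q
    using that
  proof (induction rule: inc_induct)
    case base
    then show ?case by (simp add: D_def diag_one)
  next
    case (step q)
    have "D (Suc q) (enc (\<beta>[q := w])) = D (Suc q) (enc \<beta>)" for \<beta> w
      unfolding D_def by (intro prod.cong) (auto simp: begins_within_def)
    then have "cp_map n (model n r) q (diag (D (Suc q)))
        = diag (\<lambda>m. r\<^sup>2 * of_bool (begins_within n q (dec m)) * D (Suc q) m)"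
      using step.hyps by (intro cp_map_model_diag[OF _ DK]) (simp_all add: k_def)
    moreover have "D (Suc q) m - r\<^sup>2 * of_bool (begins_within n q (dec m)) * D (Suc q) m = D q m" for m
      using step.hyps by (simp add: D_def prod.atLeast_Suc_lessThan algebra_simps)
    ultimately show ?case
      using step by (simp add: upt_conv_Cons diag_diff[OF DK eK])
  qed
  then have "defect n (model n r) id_blinfun = diag (D 0)"
    by (simp add: defect_def k_def)
  moreover have "(1 - r\<^sup>2) ^ k \<le> D 0 m" for m
  proof -
    have "(\<Prod>i\<in>{0..<k}. 1 - r\<^sup>2) \<le> D 0 m"
      unfolding D_def using factor r2 by (intro prod_mono) auto
    then show ?thesis by simp
  qed
  ultimately have "positive_invertible (defect n (model n r) id_blinfun)"
    using r2 D1 by (auto intro!: positive_invertible_diag[of "(1 - r\<^sup>2) ^ k"])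
  moreover have "norm (\<Sum>j<n ! i. model n r i j o\<^sub>L adj (model n r i j)) < 1" if "i < length n" for i
  proof -
    have "(\<Sum>j<n ! i. model n r i j o\<^sub>L adj (model n r i j)) = cp_map n (model n r) i (diag (\<lambda>m. 1))"
        unfolding cp_map_def diag_one by (intro sum.cong blinfun_eqI) simp_all
    also have "\<dots> = diag (\<lambda>m. r\<^sup>2 * of_bool (begins_within n i (dec m)))"
      using cp_map_model_diag[OF that, of "\<lambda>m. 1" 1 r] by simp
    also have "norm \<dots> \<le> r\<^sup>2"
      by (rule norm_diag_le) auto
    finally show ?thesis using r2 by simp
  qed
  ultimately show ?thesis
    using model_commuting by (simp add: polyball_def)
qed

text \<open>The tuple \<open>S\<close> itself need not lie in the polyball; it is the limit of \<open>rS\<close> as \<open>r\<close> tends to \<open>1\<close> from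
  below.\<close>

lemma model_in_closed_polyball: "model n s \<in> closed_polyball s n"
proof -
  have "continuous_on (closure {0..<1}) (model n)"
    unfolding model_def
  proof (intro continuous_on_coordinatewise_then_product)
    show "continuous_on (closure {0..<1})
        (\<lambda>r :: real. if i < length n \<and> j < n ! i then r *\<^sub>R creation i j else 0)" for i j
      by (cases "i < length n \<and> j < n ! i") (auto intro!: continuous_intros)
  qed
  then have "model n ` closure {0..<1} \<subseteq> closure (polyball n)"
    by (rule image_closure_subset)
      (auto intro!: closed_closure subsetD[OF closure_subset] model_in_polyball)
  then have "model n 1 \<in> closure (polyball n)" by auto
  moreover have "model n s = scale_tuple s (model n 1)" by (simp add: scale_tuple_model)
  ultimately show ?thesis unfolding closed_polyball_def by blast
qed

definition unit_vec :: "nat list list \<Rightarrow> (nat, complex) l2" where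
  "unit_vec \<beta> = Abs_l2 (\<lambda>m. if m = enc \<beta> then 1 else 0)"

lemma unit_vec_apply: "l2_apply (unit_vec \<beta>) m = (if m = enc \<beta> then 1 else 0)"
proof -
  have "(\<lambda>m. (norm (if m = enc \<beta> then 1 else 0 :: complex))\<^sup>2) summable_on UNIV
      \<longleftrightarrow> (\<lambda>m. 1 :: real) summable_on {enc \<beta>}"
    by (rule summable_on_cong_neutral) auto
  then show ?thesis by (simp add: unit_vec_def Abs_l2_inverse)
qed

lemma cinner_unit_vec: "cinner (unit_vec \<alpha>) (unit_vec \<beta>) = (if \<alpha> = \<beta> then 1 else 0)"
proof -
  have "cinner (unit_vec \<alpha>) (unit_vec \<beta>)
      = (\<Sum>\<^sub>\<infinity>m\<in>{enc \<alpha>}. if \<alpha> = \<beta> then 1 else 0)"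
    unfolding cinner_l2_def
    by (rule infsum_cong_neutral) (auto simp: unit_vec_apply cinner_complex_def)
  then show ?thesis by simp
qed

lemma norm_unit_vec: "norm (unit_vec \<alpha>) = 1"
proof -
  have "complex_of_real ((norm (unit_vec \<alpha>))\<^sup>2) = of_real 1"
    by (simp only: norm_sq_eq_cinner cinner_unit_vec) simp
  then have "(norm (unit_vec \<alpha>))\<^sup>2 = 1\<^sup>2" by (simp only: of_real_eq_iff) simp
  then show ?thesis by (rule power2_eq_imp_eq) simp_all
qed

lemma creation_unit_vec:
  assumes "i < length \<beta>"
  shows "creation i j (unit_vec \<beta>) = unit_vec (\<beta>[i := j # \<beta> ! i])"
proof (rule l2_eqI)
  fix m
  have "begins i j (dec m) \<and> (dec m)[i := tl (dec m ! i)] = \<beta> \<longleftrightarrow> dec m = \<beta>[i := j # \<beta> ! i]"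
    using assms begins_update_tl[of i j "dec m"] by (auto simp: begins_def)
  moreover have "m = enc (\<beta>[i := j # \<beta> ! i]) \<longleftrightarrow> dec m = \<beta>[i := j # \<beta> ! i]"
    by (metis dec_enc enc_dec)
  ultimately show "l2_apply (creation i j (unit_vec \<beta>)) m = l2_apply (unit_vec (\<beta>[i := j # \<beta> ! i])) m"
    by (auto simp: creation_apply unit_vec_apply)
qed

lemma word_op_model:
  assumes "i < length n" "i < length \<beta>" "set w \<subseteq> {..<n ! i}"
  shows "word_op (model n s) i w (unit_vec \<beta>) = s ^ length w *\<^sub>R unit_vec (\<beta>[i := w @ \<beta> ! i])"
  using assms(3)
proof (induction w)
  case Nil
  then show ?case by (simp add: word_op_Nil)
next
  case (Cons j w)
  then show ?case
    using assms(1,2)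
    by (simp add: word_op_Cons model_def blinfun.scaleR_right scaleR_blinfun.rep_eq creation_unit_vec)
qed

text \<open>The vacuum vector is the unit vector at the tuple of empty words. The components act from the last
  to the first, each one filling in its word; the induction runs along this process.\<close>

lemma multi_word_op_model:
  assumes "\<alpha> \<in> multi_words n"
  shows "multi_word_op (model n s) \<alpha> (unit_vec (replicate (length n) []))
    = s ^ sum_list (map length \<alpha>) *\<^sub>R unit_vec \<alpha>"
proof -
  let ?k = "length n" and ?vac = "unit_vec (replicate (length n) [])"
  have len: "length \<alpha> = ?k" and letters: "\<And>i. i < ?k \<Longrightarrow> set (\<alpha> ! i) \<subseteq> {..<n ! i}"
    using assms by (auto simp: multi_words_def)
  have "foldr (\<lambda>i T. word_op (model n s) i (\<alpha> ! i) o\<^sub>L T) [q..<?k] id_blinfun ?vac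
      = s ^ sum_list (map length (drop q \<alpha>)) *\<^sub>R unit_vec (replicate q [] @ drop q \<alpha>)"
    if "q \<le> ?k" for q
    using that
  proof (induction rule: inc_induct)
    case base
    then show ?case by (simp add: len)
  next
    case (step q)
    have "(replicate (Suc q) [] @ drop (Suc q) \<alpha>)[q := \<alpha> ! q] = replicate q [] @ drop q \<alpha>"
      using step.hyps len replicate_append_same[of q "[] :: nat list"]
      by (simp add: list_update_append Cons_nth_drop_Suc flip: replicate_append_same)
    moreover have "(replicate (Suc q) [] @ drop (Suc q) \<alpha>) ! q = []"
      by (simp add: nth_append del: replicate_Suc)
    moreover have "drop q \<alpha> = \<alpha> ! q # drop (Suc q) \<alpha>"
      using step.hyps len by (simp add: Cons_nth_drop_Suc)
    ultimately show ?case
      using step len letters[of q]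
      by (simp add: upt_conv_Cons blinfun.scaleR_right word_op_model power_add mult.commute
          del: replicate_Suc)
  qed
  from this[of 0] show ?thesis by (simp add: multi_word_op_def len)
qed

lemma norm_sum_tensor_orthogonal:
  assumes "finite F" "\<And>i j. i \<in> F \<Longrightarrow> j \<in> F \<Longrightarrow> cinner (v i) (v j) = (if i = j then of_real a else 0)"
  shows "(norm (\<Sum>i\<in>F. tensor (u i) (v i)))\<^sup>2 = a * (\<Sum>i\<in>F. (norm (u i))\<^sup>2)"
proof -
  have "complex_of_real ((norm (\<Sum>i\<in>F. tensor (u i) (v i)))\<^sup>2)
      = (\<Sum>i\<in>F. \<Sum>j\<in>F. cinner (u i) (u j) * cinner (v i) (v j))"
    by (simp only: norm_sq_eq_cinner cinner_sum_left) (simp add: cinner_sum_right cinner_tensor)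
  also have "\<dots> = (\<Sum>i\<in>F. \<Sum>j\<in>F. if i = j then cinner (u i) (u j) * of_real a else 0)"
    by (intro sum.cong) (auto simp: assms(2))
  also have "\<dots> = complex_of_real (a * (\<Sum>i\<in>F. (norm (u i))\<^sup>2))"
    using assms(1) by (simp add: cinner_self sum_distrib_left mult.commute)
  finally show ?thesis by (simp only: of_real_eq_iff)
qed

text \<open>On \<open>x \<otimes> vacuum\<close> the summands \<open>A\<^sub>\<alpha> x \<otimes> s\<^sup>|\<^sup>p\<^sup>| e\<^sub>\<alpha>\<close> are pairwise orthogonal. This turns an upper bound for
  the norm of the homogeneous part into a bound for the column of coefficients.\<close>

lemma norm_homogeneous_part_model_ge:
  assumes A: "\<forall>\<alpha>\<in>multi_words n. A \<alpha> \<in> bounded_ops" and "0 < s"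
  shows "s ^ sum_list p * sqrt (column_norm n A p) \<le> norm (homogeneous_part n A (model n s) p)"
proof -
  define F where "F = multi_words_of_degree n p"
  define H where "H = homogeneous_part n A (model n s) p"
  define N where "N = sum_list p"
  have A': "A \<alpha> \<in> bounded_ops" if "\<alpha> \<in> F" for \<alpha>
    using A that by (auto simp: F_def multi_words_of_degree_def)
  have bound: "(\<Sum>\<alpha>\<in>F. (norm (A \<alpha> x))\<^sup>2) \<le> (norm H / s ^ N)\<^sup>2 * (norm x)\<^sup>2" for x
  proof -
    let ?vac = "unit_vec (replicate (length n) [])"
    have "H (tensor x ?vac) = (\<Sum>\<alpha>\<in>F. tensor (A \<alpha> x) (s ^ N *\<^sub>R unit_vec \<alpha>))"
      unfolding H_def homogeneous_part_def F_def[symmetric] blinfun.sum_left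
    proof (rule sum.cong)
      fix \<alpha> assume "\<alpha> \<in> F"
      then have \<alpha>: "\<alpha> \<in> multi_words n" "sum_list (map length \<alpha>) = N"
        by (auto simp: F_def multi_words_of_degree_def N_def)
      then have "multi_word_op (model n s) \<alpha> \<in> bounded_ops"
        by (rule_tac multi_word_op_bounded_ops)
          (auto simp: model_def bounded_ops_scaleR creation_bounded_ops)
      then show "tensor_op (A \<alpha>) (multi_word_op (model n s) \<alpha>) (tensor x ?vac)
          = tensor (A \<alpha> x) (s ^ N *\<^sub>R unit_vec \<alpha>)"
        using \<alpha> \<open>\<alpha> \<in> F\<close> A' by (simp add: tensor_op_tensor multi_word_op_model)
    qed simp
    then have "(norm (H (tensor x ?vac)))\<^sup>2 = (s ^ N)\<^sup>2 * (\<Sum>\<alpha>\<in>F. (norm (A \<alpha> x))\<^sup>2)"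
      by (simp only:, intro norm_sum_tensor_orthogonal)
        (auto simp: F_def finite_multi_words_of_degree scaleR_eq_scaleC cinner_scaleC_left
          cinner_scaleC_right cinner_unit_vec power2_eq_square)
    moreover have "(norm (H (tensor x ?vac)))\<^sup>2 \<le> (norm H * norm x)\<^sup>2"
      using norm_blinfun[of H "tensor x ?vac"]
      by (intro power_mono) (auto simp: norm_tensor norm_unit_vec)
    ultimately show ?thesis
      using \<open>0 < s\<close> by (simp add: power_mult_distrib power_divide pos_le_divide_eq mult.commute)
  qed
  have "column_norm n A p \<le> (norm H / s ^ N)\<^sup>2"
    unfolding column_norm_def F_def[symmetric]
    by (rule norm_sum_adj_column_le) (use A' bound in auto)
  then have "sqrt (column_norm n A p) \<le> norm H / s ^ N"
    using \<open>0 < s\<close> by (intro real_le_lsqrt) (auto simp: column_norm_nonneg)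
  then show ?thesis
    using \<open>0 < s\<close> by (simp add: H_def N_def pos_le_divide_eq mult.commute)
qed

section \<open>Convergence and divergence\<close>

lemma row_bound_mono:
  assumes "row_bound F T c" "0 \<le> c" "c \<le> d"
  shows "row_bound F T d"
proof -
  have "c\<^sup>2 * (\<Sum>i\<in>F. (norm (y i))\<^sup>2) \<le> d\<^sup>2 * (\<Sum>i\<in>F. (norm (y i))\<^sup>2)" for y :: "_ \<Rightarrow> 'b"
    using assms(2,3) by (intro mult_right_mono power_mono sum_nonneg) auto
  then show ?thesis
    unfolding row_bound_def by (intro allI order.trans[OF row_boundD[OF assms(1)]])
qed

lemma polyball_bounded_ops:
  assumes "X \<in> polyball n"
  shows "X i j \<in> bounded_ops"
proof -
  have "if i < length n \<and> j < n ! i then X i j \<in> bounded_ops else X i j = 0"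
    using assms by (simp add: polyball_def commuting_tuples_def)
  then show ?thesis using bounded_ops_zero by (simp split: if_splits)
qed

lemma row_bound_polyball:
  assumes "X \<in> polyball n"
  shows "row_bound {..<n ! i} (X i) (sqrt (norm (\<Sum>j<n ! i. X i j o\<^sub>L adj (X i j))))"
  using row_bound_norm_sum_adj[of "{..<n ! i}" "X i", OF polyball_bounded_ops[OF assms]] .

text \<open>Complex linearity and the row bound are given by equations and weak inequalities between
  continuous functions of the tuple, so they pass to the closure.\<close>

lemma closure_polyball:
  fixes X :: "'h :: chilbert_space op_tuple"
  assumes "X \<in> closure (polyball n)"
  shows "X i j \<in> bounded_ops"
    and "i < length n \<Longrightarrow> row_bound {..<n ! i} (X i) 1"
proof -
  have entry: "continuous_on UNIV (\<lambda>X :: 'h op_tuple. X i j)" for i j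
    by (rule continuous_on_product_then_coordinatewise) (rule continuous_on_product_coordinates)
  have evaluation: "continuous_on UNIV (\<lambda>X :: 'h op_tuple. X i j x)" for i j x
    by (rule blinfun.continuous_on[OF entry continuous_on_const])
  have "continuous_on UNIV (\<lambda>X :: 'h op_tuple. c *\<^sub>C X i j x)" for c i j x
  proof (rule bounded_linear.continuous_on[OF _ evaluation])
    show "bounded_linear (\<lambda>y :: 'h. c *\<^sub>C y)"
      by (rule bounded_linear_intro[where K = "cmod c"])
        (simp_all add: scaleC_add_right scaleC_scaleR_commute norm_scaleC)
  qed
  then have "closed {X :: 'h op_tuple. \<forall>i j. X i j \<in> bounded_ops}"
    unfolding bounded_ops_def mem_Collect_eq
    by (intro closed_Collect_all closed_Collect_eq evaluation)
  moreover have "closed {X :: 'h op_tuple. \<forall>i<length n. row_bound {..<n ! i} (X i) 1}"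
    unfolding row_bound_def
    by (intro closed_Collect_all closed_Collect_imp open_Collect_const closed_Collect_le
        continuous_on_power continuous_on_norm continuous_on_sum evaluation continuous_on_const)
  ultimately have closed: "closed ({X :: 'h op_tuple. \<forall>i j. X i j \<in> bounded_ops} \<inter>
      {X. \<forall>i<length n. row_bound {..<n ! i} (X i) 1})" (is "closed ?C")
    by (rule closed_Int)
  have "polyball n \<subseteq> ?C"
  proof (intro subsetI IntI CollectI allI impI)
    fix Z :: "'h op_tuple" and i j
    assume Z: "Z \<in> polyball n"
    show "Z i j \<in> bounded_ops" by (rule polyball_bounded_ops[OF Z])
    assume "i < length n"
    with Z show "row_bound {..<n ! i} (Z i) 1"
      by (intro row_bound_mono[OF row_bound_polyball[OF Z]]) (simp_all add: polyball_def less_imp_le)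
  qed
  then have "X \<in> ?C" using closure_minimal[OF _ closed] assms by blast
  then show "X i j \<in> bounded_ops" "i < length n \<Longrightarrow> row_bound {..<n ! i} (X i) 1"
    by auto
qed

text \<open>Finitely many rows, each of norm below \<open>1\<close>, have a common bound below \<open>1\<close>. The \<open>0\<close> inserted into the
  maximum makes the bound nonnegative and the set nonempty.\<close>

lemma polyball_strict_row_bound:
  assumes "X \<in> polyball n"
  obtains t where "0 \<le> t" "t < 1" "\<And>i. i < length n \<Longrightarrow> row_bound {..<n ! i} (X i) t"
proof
  let ?c = "\<lambda>i. sqrt (norm (\<Sum>j<n ! i. X i j o\<^sub>L adj (X i j)))"
  let ?t = "Max (insert 0 (?c ` {..<length n}))"
  show "0 \<le> ?t" by simp
  have "?c i < 1" if "i < length n" for i using assms that by (simp add: polyball_def)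
  then show "?t < 1" by (subst Max_less_iff) auto
  show "row_bound {..<n ! i} (X i) ?t" if "i < length n" for i
    by (rule row_bound_mono[OF row_bound_polyball[OF assms]]) (use that in simp_all)
qed

lemma scaled_polyballE:
  assumes "X \<in> scaled_polyball \<gamma> n"
  obtains \<rho> Z where "Z \<in> polyball n" "X = scale_tuple \<rho> Z" "0 \<le> \<rho>" "\<gamma> \<noteq> \<infinity> \<Longrightarrow> \<gamma> = ennreal \<rho>"
proof (cases "\<gamma> = \<infinity>")
  case True
  with assms obtain \<rho> Z where "0 < \<rho>" "Z \<in> polyball n" "X = scale_tuple \<rho> Z"
    by (auto simp: scaled_polyball_def)
  then show ?thesis using True by (intro that[of Z \<rho>]) simp_all
next
  case False
  with assms obtain Z where "Z \<in> polyball n" "X = scale_tuple (enn2real \<gamma>) Z"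
    by (auto simp: scaled_polyball_def)
  then show ?thesis
    using False by (intro that[of Z "enn2real \<gamma>"]) (simp_all add: ennreal_enn2real_if)
qed

text \<open>By the Cauchy criterion a finite set \<open>H\<close> exists such that adding one more index to \<open>H\<close> changes the
  partial sum by less than \<open>e\<close>.\<close>

lemma summable_on_imp_eventually_norm_less:
  fixes f :: "'a \<Rightarrow> 'b :: real_normed_vector"
  assumes "f summable_on S" "0 < e"
  shows "\<forall>\<^sub>F x in inf cofinite (principal S). norm (f x) < e"
proof -
  from assms(1) obtain L where "(f has_sum L) S" unfolding summable_on_def ..
  then have "(sum f \<longlongrightarrow> L) (finite_subsets_at_top S)" by (simp only: has_sum_def)
  from tendstoD[OF this half_gt_zero[OF assms(2)]]
  obtain H where H': "finite H \<and> H \<subseteq> S \<and>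
      (\<forall>F. finite F \<and> H \<subseteq> F \<and> F \<subseteq> S \<longrightarrow> dist (sum f F) L < e / 2)"
    unfolding eventually_finite_subsets_at_top ..
  then have H: "finite H" "H \<subseteq> S" by simp_all
  have near: "dist (sum f F) L < e / 2" if "finite F" "H \<subseteq> F" "F \<subseteq> S" for F
    using H' that by simp
  have "norm (f x) < e" if "x \<in> S" "x \<notin> H" for x
  proof -
    have "dist (sum f (insert x H)) (sum f H) < e"
      by (rule dist_triangle_half_l[OF near near]) (use H that in auto)
    then show ?thesis using that H(1) by (simp add: dist_norm)
  qed
  then show ?thesis
    unfolding eventually_inf_principal eventually_cofinite
    by (intro finite_subset[OF _ H(1)]) auto
qed

theorem theorem1p11:
  fixes n :: "nat list"
    and A :: "nat list list \<Rightarrow> ('k :: chilbert_space \<Rightarrow>\<^sub>L 'k)"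
    and \<gamma> :: ennreal
  assumes "n \<noteq> []" and "\<forall>m\<in>set n. 1 \<le> m"
    and "\<forall>\<alpha>\<in>multi_words n. A \<alpha> \<in> bounded_ops"
    and "1 / \<gamma> = multi_limsup n (\<lambda>p. ennreal
      (norm (\<Sum>\<alpha>\<in>multi_words_of_degree n p. adj (A \<alpha>) o\<^sub>L A \<alpha>)
        powr (1 / (2 * real (sum_list p)))))"
  shows
    "((\<forall>X :: 'h :: chilbert_space op_tuple. X \<in> scaled_polyball \<gamma> n \<longrightarrow>
        (\<lambda>p. norm (homogeneous_part n A X p)) summable_on multi_degrees n) \<and>
      (\<forall>r\<ge>0. ennreal r < \<gamma> \<longrightarrow>
        uniform_limit (closed_polyball r n :: 'h op_tuple set)
          (\<lambda>F X. \<Sum>p\<in>F. norm (homogeneous_part n A X p))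
          (\<lambda>X. \<Sum>\<^sub>\<infinity>p\<in>multi_degrees n. norm (homogeneous_part n A X p))
          (finite_subsets_at_top (multi_degrees n)))) \<and>
     (\<forall>s. ennreal s > \<gamma> \<longrightarrow>
        (\<exists>Y :: (nat, complex) l2 op_tuple. Y \<in> closed_polyball s n \<and>
          \<not> homogeneous_part n A Y summable_on multi_degrees n))"
proof (intro conjI allI impI)
  note A = assms(3)
  note \<gamma> = assms(4)[folded column_norm_def]
  note radius = summable_on_radius[OF column_norm_nonneg \<gamma>]
  {
    fix X :: "'h op_tuple" assume "X \<in> scaled_polyball \<gamma> n"
    then obtain \<rho> Z where Z: "Z \<in> polyball n" "X = scale_tuple \<rho> Z" "0 \<le> \<rho>"
      and \<rho>: "\<gamma> \<noteq> \<infinity> \<Longrightarrow> \<gamma> = ennreal \<rho>"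
      using scaled_polyballE[of X \<gamma> n] by metis
    obtain t where t: "0 \<le> t" "t < 1" "\<And>i. i < length n \<Longrightarrow> row_bound {..<n ! i} (Z i) t"
      using polyball_strict_row_bound[OF Z(1)] by blast
    have "(\<lambda>p. (\<rho> * t) ^ sum_list p * sqrt (column_norm n A p)) summable_on multi_degrees n"
    proof (cases "\<gamma> = 0")
      \<comment> \<open>For radius \<open>0\<close> only the term of degree \<open>0\<close> survives.\<close>
      case True
      then have "\<rho> = 0" using \<rho> Z(3) by simp
      have "(\<lambda>p. (\<rho> * t) ^ sum_list p * sqrt (column_norm n A p))
          summable_on {p \<in> multi_degrees n. sum_list p \<le> 0}"
        by (rule summable_on_finite[OF finite_degrees_le])
      then show ?thesis
        by (rule summable_on_cong_neutral[THEN iffD1, rotated -1])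
          (auto simp: \<open>\<rho> = 0\<close> simp del: sum_list_eq_0_iff)
    next
      case False
      \<comment> \<open>For finite \<open>\<gamma>\<close> the factor \<open>t < 1\<close> gives the strict inequality; for \<open>\<gamma> = \<infinity>\<close>
        any radius will do.\<close>
      have "ennreal (\<rho> * t) < \<gamma>"
      proof (cases "\<gamma> = \<infinity>")
        case False
        with \<rho> \<open>\<gamma> \<noteq> 0\<close> Z(3) have "0 < \<rho>" by (cases "\<rho> = 0") auto
        with \<rho>[OF False] t show ?thesis by (simp add: ennreal_less_iff)
      qed simp
      then show ?thesis using t Z(3) by (intro radius) auto
    qed
    then show "(\<lambda>p. norm (homogeneous_part n A X p)) summable_on multi_degrees n"
    proof (rule summable_on_comparison_test)
      show "norm (homogeneous_part n A X p) \<le> (\<rho> * t) ^ sum_list p * sqrt (column_norm n A p)"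
        if "p \<in> multi_degrees n" for p
        using that Z(2,3) t
        by (intro norm_homogeneous_part_le[OF A])
          (simp_all add: scale_tuple_def row_bound_scaleR bounded_ops_scaleR
            polyball_bounded_ops[OF Z(1)])
    qed simp
  }
  {
    fix r :: real assume r: "0 \<le> r" "ennreal r < \<gamma>"
    have "norm (homogeneous_part n A X p) \<le> r ^ sum_list p * sqrt (column_norm n A p)"
      if X: "X \<in> closed_polyball r n" and p: "p \<in> multi_degrees n" for X :: "'h op_tuple" and p
    proof -
      from X obtain Z where "Z \<in> closure (polyball n)" and X: "X = scale_tuple r Z"
        by (auto simp: closed_polyball_def)
      note Z = closure_polyball[OF this(1)]
      have "row_bound {..<n ! i} (X i) r" if "i < length n" for i
        using row_bound_scaleR[OF Z(2)[OF that], of r] by (simp add: X scale_tuple_def)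
      then show ?thesis
        using r p Z(1) by (intro norm_homogeneous_part_le[OF A])
          (auto simp: X scale_tuple_def intro!: bounded_ops_scaleR)
    qed
    then show "uniform_limit (closed_polyball r n :: 'h op_tuple set)
        (\<lambda>F X. \<Sum>p\<in>F. norm (homogeneous_part n A X p))
        (\<lambda>X. \<Sum>\<^sub>\<infinity>p\<in>multi_degrees n. norm (homogeneous_part n A X p))
        (finite_subsets_at_top (multi_degrees n))"
      by (intro Weierstrass_m_test_general[OF _ radius[OF r]]) simp
  }
  fix s assume s: "\<gamma> < ennreal s"
  show "\<exists>Y :: (nat, complex) l2 op_tuple. Y \<in> closed_polyball s n \<and>
      \<not> homogeneous_part n A Y summable_on multi_degrees n"
  proof (intro exI conjI notI)
    show "model n s \<in> closed_polyball s n" by (rule model_in_closed_polyball)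
    assume summable: "homogeneous_part n A (model n s) summable_on multi_degrees n"
    have "0 < s" using s by (cases "0 < s") (simp_all add: ennreal_neg)
    let ?Fil = "inf cofinite (principal (multi_degrees n))"
    have "\<forall>\<^sub>F p in ?Fil. norm (homogeneous_part n A (model n s) p) < 1"
      by (rule summable_on_imp_eventually_norm_less[OF summable]) simp
    with eventually_multi_degrees_sum_list_ge[of 1 n]
    have "\<forall>\<^sub>F p in ?Fil.
        ennreal (column_norm n A p powr (1 / (2 * real (sum_list p)))) \<le> ennreal (1 / s)"
    proof eventually_elim
      case (elim p)
      have "s ^ sum_list p * sqrt (column_norm n A p) \<le> 1"
        using norm_homogeneous_part_model_ge[OF A \<open>0 < s\<close>, of p] elim by simp
      then have "sqrt (column_norm n A p) \<le> (1 / s) ^ sum_list p"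
        using \<open>0 < s\<close> by (simp add: power_divide pos_le_divide_eq mult.commute)
      then have "column_norm n A p powr (1 / (2 * real (sum_list p))) \<le> 1 / s"
        using elim \<open>0 < s\<close> column_norm_nonneg by (subst powr_half_inverse_le_iff) auto
      then show ?case by (rule ennreal_leI)
    qed
    then have "1 / \<gamma> \<le> ennreal (1 / s)"
      unfolding \<gamma> multi_limsup_def by (rule Limsup_bounded)
    with less_one_divide_ennreal[OF s] show False by simp
  qed
qed

end
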